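(* Let $\mu$ be a measure on $\mathbb{R}^2$ with an even log-concave density. Then: (1) for all symmetric convex bodies $K,L$ in $\mathbb{R}^2$ and all $\lambda\in(0,1)$, $$\mu\big(\lambda\cdot K+_0(1-\lambda)\cdot L\big)\geq\mu(K)^{\lambda}\mu(L)^{1-\lambda};$$ (2) for every symmetric convex body $K$ in $\mathbb{R}^2$, the function $\mathbb{R}\ni t\mapsto\mu(e^tK)$ is log-concave.
   Context: A convex body is a compact convex set with non-empty interior; it is symmetric if $K=-K$. The support function of $K$ is $h_K(u)=\max_{y\in K}u\cdot y$. For convex bodies $K,L\subset\mathbb{R}^n$ containing the origin in their interiors and $\lambda\in(0,1)$, the logarithmic sum is $$\lambda\cdot K+_0(1-\lambda)\cdot L=\{x\in\mathbb{R}^n : x\cdot u\le h_K(u)^{\lambda}h_L(u)^{1-\lambda}\ \text{for all } u\in S^{n-1}\}.$$ A non-negative function is log-concave if its logarithm (with values in $[-\infty,\infty)$) is concave; a function $f$ is even if $f(-x)=f(x)$. *)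

theory Defs
  imports "HOL-Analysis.Analysis"
begin

definition convex_body :: "'a::euclidean_space set \<Rightarrow> bool" where
  "convex_body K \<longleftrightarrow> compact K \<and> convex K \<and> interior K \<noteq> {}"

definition symmetric_convex_body :: "'a::euclidean_space set \<Rightarrow> bool" where
  "symmetric_convex_body K \<longleftrightarrow> convex_body K \<and> K = uminus ` K"

text \<open>For nonempty compact \<open>K\<close> the supremum is attained, so it is the maximum.\<close>

definition support_function :: "'a::euclidean_space set \<Rightarrow> 'a \<Rightarrow> real" where
  "support_function K u = (SUP y\<in>K. u \<bullet> y)"

text \<open>The logarithmic sum of \<open>K\<close> and \<open>L\<close> with weights \<open>lam\<close> and \<open>1 - lam\<close>. It is meant for bodies
  with the origin in their interiors, whose support functions are positive on the unit sphere;
  every symmetric convex body is of this kind.\<close>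

definition log_sum :: "real \<Rightarrow> 'a::euclidean_space set \<Rightarrow> 'a set \<Rightarrow> 'a set" where
  "log_sum lam K L =
    {x. \<forall>u\<in>sphere 0 1.
      x \<bullet> u \<le> support_function K u powr lam * support_function L u powr (1 - lam)}"

text \<open>The logarithm on \<open>[0, \<infinity>)\<close> with values in \<open>[-\<infinity>, \<infinity>)\<close>; HOL's real \<open>ln\<close> satisfies \<open>ln 0 = 0\<close>.\<close>

definition eln :: "real \<Rightarrow> ereal" where
  "eln r = (if r > 0 then ereal (ln r) else -\<infinity>)"

text \<open>Since \<open>eln\<close> never takes the value \<open>\<infinity>\<close>, the sum below is never of the form \<open>\<infinity> - \<infinity>\<close>; at
  \<open>t = 0\<close> and \<open>t = 1\<close> the convention \<open>0 * (-\<infinity>) = 0\<close> of \<open>ereal\<close> makes the inequality trivial.\<close>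

definition log_concave :: "('a::real_vector \<Rightarrow> real) \<Rightarrow> bool" where
  "log_concave f \<longleftrightarrow> (\<forall>x. 0 \<le> f x) \<and>
    (\<forall>x y. \<forall>t\<in>{0..1}.
      eln (f ((1 - t) *\<^sub>R x + t *\<^sub>R y)) \<ge> ereal (1 - t) * eln (f x) + ereal t * eln (f y))"

end

(*
  By Fubini along a direction u, two symmetric plane bodies K, L with the widths a, b in direction u
  satisfy |K + L| >= (a + b) (|K| / a + |L| / b), because the section of K + L at height (a + b) s
  contains the sum of the sections of K at a s and of L at b s.

  Fix directions u_i and let P(h) = {x. |u_i . x| <= h_i}. The inequality makes the square root of
  |P(h)| superadditive, so it has a supergradient m >= 0 at h. For a body L with widths g_i,
  applying the inequality to P(h) and e L, which add up into P(h + e g), and letting e -> 0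
  gives |L| * sum m_i h_i^2 / g_i <= |P(h)| * sum m_i g_i. For two bodies with g_i g'_i <= h_i^2
  the factors of the two resulting estimates cancel, and |L| |L'| <= |P(h)|^2 remains.
  With u_i running through a dense sequence this is the log-Brunn-Minkowski inequality for
  lam = 1/2; midpoint concavity and continuity in lam give it for all lam.

  For the measure mu, write mu(K) as the integral of exp (-x) |K \<inter> {f >= exp (-x)}| over x. The
  log-Brunn-Minkowski inequality for K \<inter> {f >= s} and L \<inter> {f >= t} is the hypothesis of the
  one-dimensional Prekopa-Leindler inequality, which gives (1). Since the logarithmic sum of e^s K
  and e^t K is a dilate of K, (2) is the special case of (1) for dilates.
*)
theory Submission
  imports Defs
begin

subsection \<open>Areas of sums with aligned sections\<close>

text \<open>The area inequality is kept with its free widths a and b, because its optimized form,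
  Brunn-Minkowski, loses the direction. With x = |P(h)|, its first-order version in direction u_i
  reads g_i x / h_i + h_i |L| / g_i <= 2 sqrt x * sum m_k g_k. Multiplying by m_i h_i, weights whose
  sum is sqrt x, and adding up turns the first terms into x * sum m_k g_k, half of the right-hand
  side. What is left are the terms h_i^2 / g_i, the ones to which the condition on g g' applies.
  This needs P(h) to have width exactly h_i in direction u_i, but it may be smaller. Such directions
  have m_i = 0, because lowering h_i to the true width does not change P(h). So m does the work of
  edge lengths, and the area is never differentiated. Symmetry enters through the heights: the
  sections of K at a s and of L at b s are nonempty for the same s, which the one-dimensional sum
  inequality requires.\<close>

lemma emeasure_compact_sums_real_ge:
  fixes A B :: "real set"
  assumes "compact A" "A \<noteq> {}" "compact B" "B \<noteq> {}" "S \<in> sets lborel"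
    and sub: "\<And>x y. x \<in> A \<Longrightarrow> y \<in> B \<Longrightarrow> x + y \<in> S"
  shows "emeasure lborel A + emeasure lborel B \<le> emeasure lborel S"
proof -
  obtain a where a: "a \<in> A" "\<And>x. x \<in> A \<Longrightarrow> x \<le> a"
    using compact_attains_sup[OF assms(1,2)] by blast
  obtain b where b: "b \<in> B" "\<And>x. x \<in> B \<Longrightarrow> b \<le> x"
    using compact_attains_inf[OF assms(3,4)] by blast
  have tr: "emeasure lborel ((+) c ` C) = emeasure lborel C" if "compact C" for c :: real and C
  proof -
    have "emeasure lebesgue ((+) c ` C) = emeasure lebesgue C"
      using emeasure_lebesgue_affine[of 1 c C] by (simp add: add.commute cong: image_cong_simp)
    moreover have "C \<in> sets borel" "(+) c ` C \<in> sets borel"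
      using that by (auto intro: borel_compact compact_translation)
    ultimately show ?thesis by simp
  qed
  have sets: "(+) b ` A \<in> sets lborel" "(+) a ` B \<in> sets lborel"
    using assms by (auto intro!: borel_compact compact_translation)
  \<comment> \<open>Shifting \<open>A\<close> by the minimum of \<open>B\<close> and
    \<open>B\<close> by the maximum of \<open>A\<close> puts both copies inside \<open>S\<close>,
    one to the left of \<open>a + b\<close> and one to the right.\<close>
  have "(+) b ` A \<inter> (+) a ` B \<subseteq> {a + b}"
  proof safe
    fix x y :: real assume "b + x = a + y" "x \<in> A" "y \<in> B"
    then show "b + x = a + b" using a(2)[of x] b(2)[of y] by linarith
  qed
  then have null: "emeasure lborel ((+) b ` A \<inter> (+) a ` B) = 0"
    by (metis emeasure_lborel_countable countable_subset countable_insert countable_empty)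
  have "emeasure lborel A + emeasure lborel B
      = emeasure lborel ((+) b ` A) + emeasure lborel ((+) a ` B)"
    using tr assms by simp
  also have "\<dots> = emeasure lborel ((+) b ` A \<union> (+) a ` B)"
    using emeasure_Un_Int[OF sets] null by simp
  also have "\<dots> \<le> emeasure lborel S"
    using a b sub assms(5) by (intro emeasure_mono) (auto simp: add.commute[of b] intro: sub)
  finally show ?thesis .
qed

section \<open>Fubini in the coordinates of \<open>real^2\<close>\<close>

lemma vector_2_eq: "(vector [a, b] :: real^2) = a *\<^sub>R axis 1 1 + b *\<^sub>R axis 2 1"
  by (simp add: vec_eq_iff forall_2 axis_def)

text \<open>\<open>real^2\<close> is not a product type, so Fubini has to be carried over along the
  coordinate map. Agreement on boxes is enough, since it characterizes Lebesgue measure.\<close>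

lemma lborel_distr_vector_2:
  "distr (lborel :: (real \<times> real) measure) lborel (\<lambda>(a,b). vector [a, b] :: real^2) = lborel"
proof -
  let ?T = "\<lambda>(a,b). vector [a, b] :: real^2"
  have cont: "continuous_on UNIV ?T"
    unfolding case_prod_unfold vector_2_eq by (intro continuous_intros)
  then have meas: "?T \<in> borel_measurable borel" by (rule borel_measurable_continuous_onI)
  have "lborel = distr (lborel :: (real \<times> real) measure) borel ?T"
  proof (rule lborel_eqI)
    fix l u :: "real^2" assume le: "\<And>b. b \<in> Basis \<Longrightarrow> l \<bullet> b \<le> u \<bullet> b"
    have i: "l $ i \<le> u $ i" for i
      using le[of "axis i 1"] by (simp add: inner_axis)
    have "?T -` box l u = box (l$1) (u$1) \<times> box (l$2) (u$2)"
      by (auto simp: mem_box_cart forall_2)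
    then have "emeasure (distr (lborel :: (real \<times> real) measure) borel ?T) (box l u)
      = emeasure (lborel :: (real \<times> real) measure) (box (l$1) (u$1) \<times> box (l$2) (u$2))"
      using meas by (simp add: emeasure_distr)
    also have "\<dots> = emeasure (lborel \<Otimes>\<^sub>M lborel) (box (l$1) (u$1) \<times> box (l$2) (u$2))"
      by (simp add: lborel_prod)
    also have "\<dots> = emeasure lborel (box (l$1) (u$1)) * emeasure lborel (box (l$2) (u$2))"
      by (rule lborel.emeasure_pair_measure_Times) auto
    also have "\<dots> = ennreal ((u$1 - l$1) * (u$2 - l$2))"
      using i by (simp add: ennreal_mult)
    also have "(u$1 - l$1) * (u$2 - l$2) = (\<Prod>b\<in>Basis. (u - l) \<bullet> b)"
    proof -
      have b: "(Basis :: (real^2) set) = {axis 1 1, axis 2 1}"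
        by (auto simp: Basis_vec_def) (metis exhaust_2)
      show ?thesis unfolding b by (simp add: inner_axis axis_eq_axis)
    qed
    finally show "emeasure (distr (lborel :: (real \<times> real) measure) borel ?T) (box l u) 
      = ennreal (\<Prod>b\<in>Basis. (u - l) \<bullet> b)" .
  qed simp
  then show ?thesis
    by (metis distr_cong sets_lborel)
qed

lemma emeasure_lborel_real2_sections:
  fixes K :: "(real^2) set"
  assumes "K \<in> sets borel"
  shows "emeasure lborel K = (\<integral>\<^sup>+ s. emeasure lborel {b. vector [s, b] \<in> K} \<partial>lborel)"
    and "(\<lambda>s. emeasure lborel {b. vector [s, b] \<in> K}) \<in> borel_measurable lborel"
    and "{b. vector [s, b] \<in> K} \<in> sets borel"
proof -
  let ?T = "\<lambda>(a,b). vector [a, b] :: real^2"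
  have "?T \<in> borel_measurable borel"
    unfolding case_prod_unfold vector_2_eq by (intro borel_measurable_continuous_onI continuous_intros)
  then have T: "?T \<in> measurable lborel lborel" by simp
  let ?S = "?T -` K"
  have S: "?S \<in> sets (lborel \<Otimes>\<^sub>M lborel)"
    using measurable_sets[OF T, of K] assms unfolding lborel_prod by simp
  have sec: "Pair s -` ?S = {b. vector [s, b] \<in> K}" for s by auto
  have "emeasure lborel K = emeasure (lborel :: (real \<times> real) measure) ?S"
    by (subst lborel_distr_vector_2[symmetric], subst emeasure_distr[OF T]) (use assms in auto)
  also have "\<dots> = emeasure (lborel \<Otimes>\<^sub>M lborel) ?S" by (simp add: lborel_prod)
  finally show "emeasure lborel K = (\<integral>\<^sup>+ s. emeasure lborel {b. vector [s, b] \<in> K} \<partial>lborel)"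
    using lborel.emeasure_pair_measure_alt[OF S] by (simp add: sec)
  show "(\<lambda>s. emeasure lborel {b. vector [s, b] \<in> K}) \<in> borel_measurable lborel"
    using lborel.measurable_emeasure_Pair[OF S] by (simp add: sec)
  show "{b. vector [s, b] \<in> K} \<in> sets borel"
    using sets_Pair1[OF S, of s] by (simp add: sec)
qed

text \<open>Both bodies are parametrized by the same relative height \<open>s\<close>. Integrating
  the one-dimensional inequality over \<open>s\<close> produces the factors \<open>1 / a\<close>,
  \<open>1 / b\<close> and \<open>a + b\<close> by substitution.\<close>

lemma measure_sums_ge_same_direction_axis:
  fixes K L S :: "(real^2) set"
  assumes K: "compact K" and L: "compact L" and S: "compact S"
    and sub: "\<And>x y. x \<in> K \<Longrightarrow> y \<in> L \<Longrightarrow> x + y \<in> S"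
    and "a > 0" "b > 0"
    and Ka: "(\<lambda>x. x $ 1) ` K = {-a..a}" and Lb: "(\<lambda>x. x $ 1) ` L = {-b..b}"
  shows "measure lebesgue S \<ge> (a + b) * (measure lebesgue K / a + measure lebesgue L / b)"
proof -
  define k where "k = (\<lambda>s. emeasure lborel {y. vector [s, y] \<in> K})"
  define l where "l = (\<lambda>s. emeasure lborel {y. vector [s, y] \<in> L})"
  define m where "m = (\<lambda>s. emeasure lborel {y. vector [s, y] \<in> S})"
  have bor: "K \<in> sets borel" "L \<in> sets borel" "S \<in> sets borel"
    using K L S by (auto intro: borel_compact)
  have [measurable]: "k \<in> borel_measurable borel" "l \<in> borel_measurable borel" "m \<in> borel_measurable borel"
    using bor[THEN emeasure_lborel_real2_sections(2)] by (simp_all add: k_def l_def m_def)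
  have comp: "compact {y. vector [s, y] \<in> C}" if "compact C" for s and C :: "(real^2) set"
  proof -
    have "continuous_on UNIV (\<lambda>y. vector [s, y] :: real^2)"
      unfolding vector_2_eq by (intro continuous_intros)
    then have "closed ((\<lambda>y. vector [s, y] :: real^2) -` C)"
      using that by (intro closed_vimage compact_imp_closed)
    moreover have "{y. vector [s, y] \<in> C} \<subseteq> (\<lambda>x. x $ 2) ` C"
      by (force simp: image_iff)
    moreover have "bounded ((\<lambda>x. x $ 2) ` C)"
      using that by (intro compact_imp_bounded compact_continuous_image continuous_intros)
    ultimately show ?thesis
      by (auto simp: compact_eq_bounded_closed vimage_def intro: bounded_subset)
  qed
  have v: "vector [x $ 1, x $ 2] = x" for x :: "real^2" by (simp add: vec_eq_iff forall_2)
  \<comment> \<open>For \<open>\<bar>s\<bar> \<le> 1\<close> both sections are nonempty, otherwise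
    both are empty. The mixed case, in which an empty section would spoil the bound on lengths,
    never occurs.\<close>
  have key: "k (a * s) + l (b * s) \<le> m ((a + b) * s)" for s
  proof (cases "\<bar>s\<bar> \<le> 1")
    case True
    have "{y. vector [a * s, y] \<in> K} \<noteq> {}"
    proof -
      have "\<bar>a * s\<bar> \<le> a" using True \<open>a > 0\<close> by (simp add: abs_mult mult_left_le)
      then have "a * s \<in> {-a..a}" by auto
      then obtain x where "x \<in> K" "x $ 1 = a * s" using Ka by (metis imageE)
      then show ?thesis using v[of x] by (auto intro!: exI[of _ "x $ 2"])
    qed
    moreover have "{y. vector [b * s, y] \<in> L} \<noteq> {}"
    proof -
      have "\<bar>b * s\<bar> \<le> b" using True \<open>b > 0\<close> by (simp add: abs_mult mult_left_le)
      then have "b * s \<in> {-b..b}" by auto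
      then obtain x where "x \<in> L" "x $ 1 = b * s" using Lb by (metis imageE)
      then show ?thesis using v[of x] by (auto intro!: exI[of _ "x $ 2"])
    qed
    moreover have "x + y \<in> {y. vector [(a + b) * s, y] \<in> S}" 
      if "x \<in> {y. vector [a * s, y] \<in> K}" "y \<in> {y. vector [b * s, y] \<in> L}" for x y
    proof -
      have "vector [a * s, x] + vector [b * s, y] = (vector [(a + b) * s, x + y] :: real^2)"
        by (simp add: vec_eq_iff forall_2 algebra_simps)
      then show ?thesis using sub that by (metis mem_Collect_eq)
    qed
    ultimately show ?thesis
      unfolding k_def l_def m_def
      by (intro emeasure_compact_sums_real_ge comp K L)
         (use S bor emeasure_lborel_real2_sections(3) in auto)
  next
    case False
    have "{y. vector [a * s, y] \<in> K} = {}"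
    proof -
      have "a * s \<notin> {-a..a}" using False \<open>a > 0\<close>
        by (smt (verit) atLeastAtMost_iff mult_le_cancel_left2 mult_minus_right)
      then show ?thesis using Ka by force
    qed
    moreover have "{y. vector [b * s, y] \<in> L} = {}"
    proof -
      have "b * s \<notin> {-b..b}" using False \<open>b > 0\<close>
        by (smt (verit) atLeastAtMost_iff mult_le_cancel_left2 mult_minus_right)
      then show ?thesis using Lb by force
    qed
    ultimately show ?thesis by (simp add: k_def l_def)
  qed
  have int: "emeasure lborel C = ennreal c * (\<integral>\<^sup>+ s. emeasure lborel {y. vector [c * s, y] \<in> C} \<partial>lborel)"
    if "compact C" "c > 0" for c and C :: "(real^2) set"
  proof -
    have C: "C \<in> sets borel" using that by (auto intro: borel_compact)
    show ?thesis
      using emeasure_lborel_real2_sections(1)[OF C]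
        nn_integral_real_affine[of "\<lambda>s. emeasure lborel {y. vector [s, y] \<in> C}" c 0]
        emeasure_lborel_real2_sections(2)[OF C] that by simp
  qed
  have eq: "emeasure lborel C = ennreal (measure lebesgue C)" if "compact C" for C :: "(real^2) set"
    using that emeasure_eq_measure2[OF lmeasurable_compact[OF that]] by (simp add: borel_compact)
  have i1: "(\<integral>\<^sup>+ s. k (a * s) \<partial>lborel) = ennreal (measure lebesgue K / a)"
  proof -
    have "ennreal a * (\<integral>\<^sup>+ s. k (a * s) \<partial>lborel) = ennreal a * ennreal (measure lebesgue K / a)"
      using int[OF K \<open>a>0\<close>] eq[OF K] \<open>a > 0\<close> by (simp add: k_def flip: ennreal_mult)
    then show ?thesis using \<open>a > 0\<close> by (simp add: ennreal_mult_cancel_left)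
  qed
  have i2: "(\<integral>\<^sup>+ s. l (b * s) \<partial>lborel) = ennreal (measure lebesgue L / b)"
  proof -
    have "ennreal b * (\<integral>\<^sup>+ s. l (b * s) \<partial>lborel) = ennreal b * ennreal (measure lebesgue L / b)"
      using int[OF L \<open>b>0\<close>] eq[OF L] \<open>b > 0\<close> by (simp add: l_def flip: ennreal_mult)
    then show ?thesis using \<open>b > 0\<close> by (simp add: ennreal_mult_cancel_left)
  qed
  have "ennreal ((a + b) * (measure lebesgue K / a + measure lebesgue L / b)) =
     ennreal (a + b) * (\<integral>\<^sup>+ s. k (a * s) + l (b * s) \<partial>lborel)"
    using \<open>a > 0\<close> \<open>b > 0\<close> by (subst nn_integral_add) (auto simp: i1 i2 ennreal_mult simp flip: ennreal_plus)
  also have "\<dots> \<le> ennreal (a + b) * (\<integral>\<^sup>+ s. m ((a + b) * s) \<partial>lborel)"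
    by (intro mult_left_mono nn_integral_mono key) auto
  also have "\<dots> = ennreal (measure lebesgue S)"
    using int[OF S, of "a + b"] eq[OF S] \<open>a > 0\<close> \<open>b > 0\<close> by (simp add: m_def)
  finally show ?thesis by (simp add: ennreal_le_iff)
qed

subsection \<open>Support functions of symmetric convex bodies\<close>

lemma inner_le_support_function:
  assumes "compact K" "x \<in> K" shows "u \<bullet> x \<le> support_function K u"
  unfolding support_function_def
proof (rule cSUP_upper[OF assms(2)])
  have "compact ((\<bullet>) u ` K)" using assms by (intro compact_continuous_image continuous_intros)
  then show "bdd_above ((\<bullet>) u ` K)" by (simp add: compact_imp_bounded bounded_imp_bdd_above)
qed

lemma support_function_attained:
  assumes "compact K" "K \<noteq> {}" obtains x where "x \<in> K" "u \<bullet> x = support_function K u"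
proof -
  have "compact ((\<bullet>) u ` K)" using assms by (intro compact_continuous_image continuous_intros)
  then obtain x where x: "x \<in> K" "\<And>y. y \<in> K \<Longrightarrow> u \<bullet> y \<le> u \<bullet> x"
    using compact_attains_sup[of "(\<bullet>) u ` K"] assms by auto
  then have "support_function K u \<le> u \<bullet> x"
    unfolding support_function_def using assms by (intro cSUP_least) auto
  then show ?thesis using that x inner_le_support_function[OF assms(1) x(1), of u] by force
qed

lemma support_function_le:
  assumes "K \<noteq> {}" "\<And>x. x \<in> K \<Longrightarrow> u \<bullet> x \<le> c" shows "support_function K u \<le> c"
  unfolding support_function_def using assms by (intro cSUP_least) auto

lemma support_function_mono:
  assumes "compact L" "K \<subseteq> L" "K \<noteq> {}" shows "support_function K u \<le> support_function L u"
  using assms inner_le_support_function by (intro support_function_le) auto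

lemma symmetric_convex_bodyD:
  assumes "symmetric_convex_body K"
  shows "compact K" "convex K" "interior K \<noteq> {}" "K \<noteq> {}" "\<And>x. x \<in> K \<Longrightarrow> - x \<in> K" "0 \<in> interior K" "0 \<in> K"
proof -
  show *: "compact K" "convex K" "interior K \<noteq> {}"
    using assms by (auto simp: symmetric_convex_body_def convex_body_def)
  then show "K \<noteq> {}" by auto
  show m: "- x \<in> K" if "x \<in> K" for x
    using assms that by (auto simp: symmetric_convex_body_def)
  obtain x where x: "x \<in> interior K" using * by auto
  have "- x \<in> K" using x m interior_subset by blast
  \<comment> \<open>The origin is the midpoint of the interior point \<open>x\<close> and its mirror
    image in \<open>K\<close>.\<close>
  then have "- x - (1/2) *\<^sub>R (- x - x) \<in> interior K"
    by (intro mem_interior_convex_shrink * x) auto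
  moreover have "- x - (1/2) *\<^sub>R (- x - x) = 0"
    using scaleR_half_double[of "- x"] by simp
  ultimately show "0 \<in> interior K" by simp
  then show "0 \<in> K" using interior_subset by blast
qed

lemma symmetric_convex_bodyI:
  assumes "compact K" "convex K" "\<And>x. x \<in> K \<Longrightarrow> - x \<in> K" "interior K \<noteq> {}"
  shows "symmetric_convex_body K"
proof -
  have "K = uminus ` K"
  proof safe
    fix x assume "x \<in> K" then show "x \<in> uminus ` K" using assms(3)[of x] by (intro image_eqI[of _ _ "- x"]) auto
  qed (use assms in auto)
  with assms show ?thesis by (simp add: symmetric_convex_body_def convex_body_def)
qed

lemma abs_inner_le_support_function:
  assumes "symmetric_convex_body K" "x \<in> K" shows "\<bar>u \<bullet> x\<bar> \<le> support_function K u"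
  using inner_le_support_function[of K x u] inner_le_support_function[of K "-x" u]
    symmetric_convex_bodyD[OF assms(1)] assms(2) by (auto simp: abs_le_iff)

lemma support_function_ge_radius:
  assumes "symmetric_convex_body K"
  obtains r where "r > 0" "\<And>u. r * norm u \<le> support_function K u"
proof -
  note K = symmetric_convex_bodyD[OF assms]
  obtain r where r: "r > 0" "cball 0 r \<subseteq> K" using K(6) mem_interior_cball by blast
  show ?thesis
  proof
    show "r > 0" by fact
    show "r * norm u \<le> support_function K u" for u
    proof (cases "u = 0")
      case True then show ?thesis using inner_le_support_function[OF K(1,7), of u] by simp
    next
      case False
      have "(r / norm u) *\<^sub>R u \<in> K" using r False by auto
      from inner_le_support_function[OF K(1) this, of u] show ?thesis
        using False by (simp add: dot_square_norm power2_eq_square)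
    qed
  qed
qed

lemma support_function_pos:
  assumes "symmetric_convex_body K" "u \<noteq> 0" shows "0 < support_function K u"
proof -
  obtain r where "r > 0" "r * norm u \<le> support_function K u"
    using support_function_ge_radius[OF assms(1)] by metis
  moreover from this have "0 < r * norm u" using assms(2) by simp
  ultimately show ?thesis by linarith
qed

lemma image_inner_symmetric_convex_body:
  assumes "symmetric_convex_body K"
  shows "(\<bullet>) u ` K = {- support_function K u..support_function K u}"
proof
  show "(\<bullet>) u ` K \<subseteq> {- support_function K u..support_function K u}"
    using abs_inner_le_support_function[OF assms, of _ u] by (force simp: abs_le_iff)
  note K = symmetric_convex_bodyD[OF assms]
  obtain x where x: "x \<in> K" "u \<bullet> x = support_function K u"
    using support_function_attained K by blast
  have "convex ((\<bullet>) u ` K)"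
    by (intro convex_linear_image K) (simp add: bounded_linear_inner_right bounded_linear.linear)
  moreover have "u \<bullet> x \<in> (\<bullet>) u ` K" "u \<bullet> (- x) \<in> (\<bullet>) u ` K"
    using x K(5) by blast+
  ultimately have "closed_segment (u \<bullet> (- x)) (u \<bullet> x) \<subseteq> (\<bullet>) u ` K"
    by (intro closed_segment_subset)
  moreover have "0 \<le> u \<bullet> x" using inner_le_support_function[OF K(1,7), of u] x by simp
  ultimately show "{- support_function K u..support_function K u} \<subseteq> (\<bullet>) u ` K"
    using x by (simp add: closed_segment_eq_real_ivl)
qed

lemma symmetric_convex_body_scaleR:
  assumes "symmetric_convex_body K" "c > 0" shows "symmetric_convex_body ((*\<^sub>R) c ` K)"
proof (rule symmetric_convex_bodyI)
  note K = symmetric_convex_bodyD[OF assms(1)]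
  show "compact ((*\<^sub>R) c ` K)" using K by (intro compact_scaling)
  show "convex ((*\<^sub>R) c ` K)" using K by (intro convex_scaling)
  show "- x \<in> (*\<^sub>R) c ` K" if "x \<in> (*\<^sub>R) c ` K" for x
    using that K(5) by (auto simp: image_iff intro!: bexI[of _ "- _"])
  show "interior ((*\<^sub>R) c ` K) \<noteq> {}"
    using interior_injective_linear_image[of "(*\<^sub>R) c" K] assms(2) K
    by (simp add: linear_scaleR injective_scaleR)
qed

lemma support_function_scaleR:
  assumes "compact K" "K \<noteq> {}" "c \<ge> 0"
  shows "support_function ((*\<^sub>R) c ` K) u = c * support_function K u"
proof (rule antisym)
  show "support_function ((*\<^sub>R) c ` K) u \<le> c * support_function K u"
    using assms inner_le_support_function[OF assms(1)] by (intro support_function_le) (auto intro!: mult_left_mono)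
  obtain x where x: "x \<in> K" "u \<bullet> x = support_function K u"
    using support_function_attained assms by blast
  show "c * support_function K u \<le> support_function ((*\<^sub>R) c ` K) u"
    using inner_le_support_function[of "(*\<^sub>R) c ` K" "c *\<^sub>R x" u] x assms by (auto simp: compact_scaling)
qed

lemma measure_lebesgue_scaleR:
  "c \<ge> 0 \<Longrightarrow> measure lebesgue ((*\<^sub>R) c ` K) = c^DIM('a) * measure lebesgue (K :: 'a::euclidean_space set)"
  using measure_lebesgue_affine[of c 0 K] by (simp cong: image_cong_simp)

text \<open>A linear change of coordinates makes \<open>u\<close> the first coordinate functional.
  All three areas pick up the same determinant, which cancels.\<close>

lemma measure_sums_ge_same_direction:
  fixes K L S :: "(real^2) set"
  assumes K: "symmetric_convex_body K" and L: "symmetric_convex_body L" and S: "compact S"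
    and sub: "\<And>x y. x \<in> K \<Longrightarrow> y \<in> L \<Longrightarrow> x + y \<in> S" and u: "u \<noteq> 0"
  defines "a \<equiv> support_function K u" and "b \<equiv> support_function L u"
  shows "(a + b) * (measure lebesgue K / a + measure lebesgue L / b) \<le> measure lebesgue S"
proof -
  \<comment> \<open>The second row is \<open>u\<close> turned by a right angle, so the determinant
    is the squared length of \<open>u\<close>.\<close>
  define A :: "real^2 \<Rightarrow> real^2" where "A = (\<lambda>x. vector [u \<bullet> x, vector [- u $ 2, u $ 1] \<bullet> x])"
  have lin: "linear A" unfolding A_def
    by (rule linearI) (simp_all add: vec_eq_iff forall_2 inner_simps)
  have "inj A"
  proof (rule linear_injective_0[OF lin, THEN iffD2], intro allI impI)
    fix x assume "A x = 0"
    then have 1: "u $ 1 * x $ 1 + u $ 2 * x $ 2 = 0" and 2: "u $ 1 * x $ 2 - u $ 2 * x $ 1 = 0"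
      by (auto simp: A_def vec_eq_iff forall_2 inner_vec_def sum_2)
    have "((u$1)^2 + (u$2)^2) * x $ 1 = u$1 * (u $ 1 * x $ 1 + u $ 2 * x $ 2) - u$2 * (u $ 1 * x $ 2 - u $ 2 * x $ 1)"
      "((u$1)^2 + (u$2)^2) * x $ 2 = u$2 * (u $ 1 * x $ 1 + u $ 2 * x $ 2) + u$1 * (u $ 1 * x $ 2 - u $ 2 * x $ 1)"
      by (simp_all add: algebra_simps power2_eq_square)
    then have "((u$1)^2 + (u$2)^2) * x $ 1 = 0" "((u$1)^2 + (u$2)^2) * x $ 2 = 0" by (simp_all add: 1 2)
    moreover have "(u$1)^2 + (u$2)^2 \<noteq> 0" using u by (simp add: sum_power2_eq_zero_iff vec_eq_iff forall_2)
    ultimately have "x $ 1 = 0" "x $ 2 = 0" by (metis mult_eq_0_iff)+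
    then show "x = 0" by (simp add: vec_eq_iff forall_2)
  qed
  then have det: "det (matrix A) \<noteq> 0" using det_nz_iff_inj[OF lin] by simp
  have comp: "compact (A ` C)" if "compact C" for C
    using that lin by (intro compact_continuous_image linear_continuous_on) (simp add: linear_conv_bounded_linear)
  have "(\<lambda>x. x $ 1) ` A ` K = {-a..a}" "(\<lambda>x. x $ 1) ` A ` L = {-b..b}"
    using image_inner_symmetric_convex_body[OF K, of u] image_inner_symmetric_convex_body[OF L, of u]
    by (simp_all add: image_image A_def a_def b_def)
  then have "(a + b) * (measure lebesgue (A ` K) / a + measure lebesgue (A ` L) / b) \<le> measure lebesgue (A ` S)"
    using symmetric_convex_bodyD(1)[OF K] symmetric_convex_bodyD(1)[OF L] S
      support_function_pos[OF K u] support_function_pos[OF L u] sub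
    by (intro measure_sums_ge_same_direction_axis comp) (auto simp: a_def b_def linear_add[OF lin, symmetric])
  moreover have "measure lebesgue (A ` C) = \<bar>det (matrix A)\<bar> * measure lebesgue C" if "compact C" for C
    using that by (intro measure_linear_image lin lmeasurable_compact)
  ultimately have "\<bar>det (matrix A)\<bar> * ((a + b) * (measure lebesgue K / a + measure lebesgue L / b))
     \<le> \<bar>det (matrix A)\<bar> * measure lebesgue S"
    using symmetric_convex_bodyD(1)[OF K] symmetric_convex_bodyD(1)[OF L] S by (simp add: algebra_simps)
  then show ?thesis using det by (simp add: mult_le_cancel_left_pos)
qed

text \<open>Hahn-Banach by hand: the functional on the line through \<open>h\<close> is extended to one more coordinate
  direction at a time. A point is written as \<open>t * h + x\<close> with \<open>x\<close> supported on the coordinates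
  treated so far.\<close>

lemma supergradient_homogeneous:
  fixes \<Phi> :: "(nat \<Rightarrow> real) \<Rightarrow> real" and N :: nat
  defines "P \<equiv> \<lambda>x. \<forall>i<N. 0 < x i"
  assumes super: "\<And>x y. P x \<Longrightarrow> P y \<Longrightarrow> \<Phi> x + \<Phi> y \<le> \<Phi> (\<lambda>i. x i + y i)"
    and hom: "\<And>c x. 0 < c \<Longrightarrow> P x \<Longrightarrow> \<Phi> (\<lambda>i. c * x i) = c * \<Phi> x"
    and loc: "\<And>x y. (\<And>i. i < N \<Longrightarrow> x i = y i) \<Longrightarrow> \<Phi> x = \<Phi> y"
    and h: "P h" and "0 < N"
  obtains m where "\<And>y. P y \<Longrightarrow> \<Phi> y \<le> (\<Sum>i<N. m i * y i)" "\<Phi> h = (\<Sum>i<N. m i * h i)"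
proof -
  have "\<exists>c. \<forall>t x. (\<forall>i\<ge>k. x i = 0) \<longrightarrow> P (\<lambda>i. t * h i + x i) \<longrightarrow>
      \<Phi> (\<lambda>i. t * h i + x i) \<le> t * \<Phi> h + (\<Sum>i<k. c i * x i)" if "k \<le> N" for k
    using that
  proof (induction k)
    case 0
    have "\<Phi> (\<lambda>i. t * h i + x i) \<le> t * \<Phi> h" if "\<forall>i\<ge>0. x i = 0" "P (\<lambda>i. t * h i + x i)" for t x
    proof -
      \<comment> \<open>Positivity of the point forces \<open>t > 0\<close>, so that homogeneity
        gives even equality. This is where at least one coordinate is needed.\<close>
      have "0 < t * h 0" using that \<open>0 < N\<close> by (auto simp: P_def)
      moreover have "0 < h 0" using h \<open>0 < N\<close> by (auto simp: P_def)
      ultimately have "t > 0" by (simp add: zero_less_mult_iff)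
      then show ?thesis using hom[OF _ h] that by simp
    qed
    then show ?case by simp
  next
    case (Suc k)
    then obtain c where c: "\<And>t x. (\<forall>i\<ge>k. x i = 0) \<Longrightarrow> P (\<lambda>i. t * h i + x i) \<Longrightarrow>
      \<Phi> (\<lambda>i. t * h i + x i) \<le> t * \<Phi> h + (\<Sum>i<k. c i * x i)" by auto
    define e :: "nat \<Rightarrow> real" where "e = (\<lambda>i. if i = k then 1 else 0)"
    have pos_h: "0 < h i" if "i < N" for i using h that by (auto simp: P_def)
    \<comment> \<open>These are the lower bounds that the points with coordinate \<open>+ e\<close>
      impose on the new coefficient; the points with \<open>- e\<close> impose upper bounds.\<close>
    define up where "up = {\<Phi> (\<lambda>i. t * h i + x i + e i) - t * \<Phi> h - (\<Sum>i<k. c i * x i) | t x.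
        (\<forall>i\<ge>k. x i = 0) \<and> P (\<lambda>i. t * h i + x i + e i)}"
    \<comment> \<open>Adding a point of each kind cancels \<open>e\<close>. Superadditivity and the
      induction hypothesis for the sum then show that every lower bound is below every upper
      bound.\<close>
    have bound: "z \<le> t * \<Phi> h + (\<Sum>i<k. c i * x i) - \<Phi> (\<lambda>i. t * h i + x i - e i)"
      if z: "z \<in> up" and x: "\<forall>i\<ge>k. x i = 0" "P (\<lambda>i. t * h i + x i - e i)" for z t x
    proof -
      obtain s y where y: "\<forall>i\<ge>k. y i = 0" "P (\<lambda>i. s * h i + y i + e i)"
        and z: "z = \<Phi> (\<lambda>i. s * h i + y i + e i) - s * \<Phi> h - (\<Sum>i<k. c i * y i)"
        using z by (auto simp: up_def)
      have eq: "(\<lambda>i. (s * h i + y i + e i) + (t * h i + x i - e i)) = (\<lambda>i. (s + t) * h i + (y i + x i))"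
        by (simp add: algebra_simps)
      have P: "P (\<lambda>i. (s + t) * h i + (y i + x i))"
        unfolding P_def
      proof (intro allI impI)
        fix i assume "i < N"
        then have "0 < s * h i + y i + e i" "0 < t * h i + x i - e i" using x y by (auto simp: P_def)
        then show "0 < (s + t) * h i + (y i + x i)" by (simp add: algebra_simps)
      qed
      have "\<Phi> (\<lambda>i. s * h i + y i + e i) + \<Phi> (\<lambda>i. t * h i + x i - e i) \<le> \<Phi> (\<lambda>i. (s + t) * h i + (y i + x i))"
        using super[OF y(2) x(2)] by (simp only: eq)
      also have "\<dots> \<le> (s + t) * \<Phi> h + (\<Sum>i<k. c i * (y i + x i))"
        using x y by (intro c P) auto
      finally show ?thesis by (simp add: z algebra_simps sum.distrib)
    qed
    have ne: "up \<noteq> {}"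
    proof -
      have "P (\<lambda>i. 1 * h i + 0 + e i)" using pos_h by (auto simp: P_def e_def add_pos_nonneg)
      then show ?thesis unfolding up_def by (auto intro!: exI[of _ 1] exI[of _ "\<lambda>_. 0"])
    qed
    have "h k > 0" using pos_h Suc.prems by simp
    \<comment> \<open>The choice \<open>t = 2 / h k\<close> leaves the value 1 in coordinate
      \<open>k\<close> after \<open>e\<close> is subtracted, so there is at least one upper
      bound.\<close>
    then have "P (\<lambda>i. (2 / h k) * h i + 0 - e i)" using pos_h by (auto simp: P_def e_def)
    then have bdd: "bdd_above up"
      using bound[of _ "\<lambda>_. 0" "2 / h k"] by (intro bdd_aboveI) blast
    define d where "d = Sup up"
    have low: "\<Phi> (\<lambda>i. t * h i + x i + e i) \<le> t * \<Phi> h + (\<Sum>i<k. c i * x i) + d"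
      if "\<forall>i\<ge>k. x i = 0" "P (\<lambda>i. t * h i + x i + e i)" for t x
    proof -
      have "\<Phi> (\<lambda>i. t * h i + x i + e i) - t * \<Phi> h - (\<Sum>i<k. c i * x i) \<le> d"
        unfolding d_def by (rule cSup_upper[OF _ bdd]) (use that in \<open>auto simp: up_def\<close>)
      then show ?thesis by simp
    qed
    have high: "\<Phi> (\<lambda>i. t * h i + x i - e i) \<le> t * \<Phi> h + (\<Sum>i<k. c i * x i) - d"
      if "\<forall>i\<ge>k. x i = 0" "P (\<lambda>i. t * h i + x i - e i)" for t x
    proof -
      have "d \<le> t * \<Phi> h + (\<Sum>i<k. c i * x i) - \<Phi> (\<lambda>i. t * h i + x i - e i)"
        unfolding d_def using bound[OF _ that] by (intro cSup_least ne) auto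
      then show ?thesis by simp
    qed
    have "\<Phi> (\<lambda>i. t * h i + x i) \<le> t * \<Phi> h + (\<Sum>i<Suc k. (c(k := d)) i * x i)"
      if x: "\<forall>i\<ge>Suc k. x i = 0" "P (\<lambda>i. t * h i + x i)" for t x
    proof -
      define x0 where "x0 = x(k := 0)"
      have x0: "x0 i = 0" if "i \<ge> k" for i using x that by (auto simp: x0_def)
      have sum: "(\<Sum>i<Suc k. (c(k := d)) i * x i) = (\<Sum>i<k. c i * x0 i) + d * x k"
        by (simp add: x0_def)
      have xe: "x i = x0 i + x k * e i" for i by (simp add: x0_def e_def)
      have scale: "(\<Sum>i<k. c i * (x0 i / r)) = (\<Sum>i<k. c i * x0 i) / r" for r
        by (simp add: sum_divide_distrib)
      \<comment> \<open>Homogeneity reduces a nonzero \<open>x k\<close> to the coefficients 1 and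
        -1 of \<open>e\<close>, which \<open>low\<close> and \<open>high\<close> cover.\<close>
      consider "x k = 0" | "x k > 0" | "x k < 0" by linarith
      then show ?thesis
      proof cases
        case 1
        then have "x = x0" by (metis x0_def fun_upd_triv)
        then show ?thesis using c[of x0 t] x0 x 1 sum by simp
      next
        case 2
        let ?r = "x k"
        have eq: "t * h i + x i = ?r * (t / ?r * h i + x0 i / ?r + e i)" for i
          using 2 by (subst (1) xe) (simp add: field_simps)
        have P: "P (\<lambda>i. t / ?r * h i + x0 i / ?r + e i)"
          using x(2) 2 unfolding P_def eq by (simp add: zero_less_mult_iff)
        have "\<Phi> (\<lambda>i. t * h i + x i) = ?r * \<Phi> (\<lambda>i. t / ?r * h i + x0 i / ?r + e i)"
          unfolding eq by (rule hom[OF 2 P])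
        also have "\<dots> \<le> ?r * (t / ?r * \<Phi> h + (\<Sum>i<k. c i * (x0 i / ?r)) + d)"
          using 2 x0 by (intro mult_left_mono low P) auto
        also have "\<dots> = t * \<Phi> h + ((\<Sum>i<k. c i * x0 i) + d * x k)"
          unfolding scale using 2 by (simp add: field_simps)
        finally show ?thesis by (simp only: sum)
      next
        case 3
        let ?r = "- x k"
        have r: "?r > 0" using 3 by simp
        have eq: "t * h i + x i = ?r * (t / ?r * h i + x0 i / ?r - e i)" for i
          using 3 by (subst (1) xe) (simp add: field_simps)
        have P: "P (\<lambda>i. t / ?r * h i + x0 i / ?r - e i)"
          using x(2) r unfolding P_def eq by (metis zero_less_mult_pos)
        have "\<Phi> (\<lambda>i. t * h i + x i) = ?r * \<Phi> (\<lambda>i. t / ?r * h i + x0 i / ?r - e i)"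
          unfolding eq by (rule hom[OF r P])
        also have "\<dots> \<le> ?r * (t / ?r * \<Phi> h + (\<Sum>i<k. c i * (x0 i / ?r)) - d)"
          using r x0 by (intro mult_left_mono high P) auto
        also have "\<dots> = t * \<Phi> h + ((\<Sum>i<k. c i * x0 i) + d * x k)"
          unfolding scale using 3 by (simp add: field_simps)
        finally show ?thesis by (simp only: sum)
      qed
    qed
    then show ?case by blast
  qed
  from this[of N] obtain m where m: "\<And>t x. (\<forall>i\<ge>N. x i = 0) \<Longrightarrow> P (\<lambda>i. t * h i + x i) \<Longrightarrow>
      \<Phi> (\<lambda>i. t * h i + x i) \<le> t * \<Phi> h + (\<Sum>i<N. m i * x i)" by blast
  have all: "\<Phi> y \<le> t * \<Phi> h + (\<Sum>i<N. m i * (y i - t * h i))" if "P y" for t y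
  proof -
    define x where "x = (\<lambda>i. if i < N then y i - t * h i else 0)"
    have "\<Phi> y = \<Phi> (\<lambda>i. t * h i + x i)" by (rule loc) (simp add: x_def)
    also have "\<dots> \<le> t * \<Phi> h + (\<Sum>i<N. m i * x i)"
      using that by (intro m) (auto simp: x_def P_def)
    also have "(\<Sum>i<N. m i * x i) = (\<Sum>i<N. m i * (y i - t * h i))" by (intro sum.cong) (auto simp: x_def)
    finally show ?thesis .
  qed
  \<comment> \<open>In \<open>all\<close>, the parameter \<open>t\<close> is still free. With
    \<open>y = h\<close>, the value 2 bounds the functional at \<open>h\<close> from above by
    \<open>\<Phi> h\<close>, and the value 0 bounds it from below.\<close>
  have "(\<Sum>i<N. m i * (h i - 2 * h i)) = - (\<Sum>i<N. m i * h i)" by (simp add: sum_negf)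
  then have "(\<Sum>i<N. m i * h i) \<le> \<Phi> h" using all[OF h, of 2] by simp
  then show ?thesis using that[of m] all[OF _, of _ 0] h by (simp add: antisym)
qed

lemma measure_symmetric_convex_body_pos:
  assumes "symmetric_convex_body K" shows "0 < measure lebesgue K"
proof -
  note K = symmetric_convex_bodyD[OF assms]
  have "\<not> negligible K"
    using open_not_negligible[of "interior K"] K(3) negligible_subset[OF _ interior_subset] by blast
  then have "measure lebesgue K \<noteq> 0"
    using negligible_iff_measure lmeasurable_compact[OF K(1)] by blast
  then show ?thesis by (simp add: less_le)
qed

subsection \<open>Intersections of symmetric slabs\<close>

text \<open>Boundedness for unit widths says that the normals span the plane. It passes to all
  positive widths, since every \<open>body h\<close> lies in a dilate of the unit one.\<close>

locale slab_system =
  fixes N :: nat and u :: "nat \<Rightarrow> real^2"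
  assumes bounded_unit: "bounded {x. \<forall>i<N. \<bar>u i \<bullet> x\<bar> \<le> 1}"
    and N_pos: "0 < N"
    and nonzero: "\<And>i. i < N \<Longrightarrow> u i \<noteq> 0"
begin

definition body :: "(nat \<Rightarrow> real) \<Rightarrow> (real^2) set" where
  "body h = {x. \<forall>i<N. \<bar>u i \<bullet> x\<bar> \<le> h i}"

text \<open>The square root makes the area homogeneous of degree one, as
  \<open>supergradient_homogeneous\<close> demands.\<close>

definition rad :: "(nat \<Rightarrow> real) \<Rightarrow> real" where
  "rad h = sqrt (measure lebesgue (body h))"

lemma body_scale: 
  assumes "0 < c" shows "body (\<lambda>i. c * h i) = (*\<^sub>R) c ` body h"
proof (intro equalityI subsetI)
  fix x assume "x \<in> body (\<lambda>i. c * h i)"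
  then have "(1 / c) *\<^sub>R x \<in> body h" using assms by (auto simp: body_def abs_mult field_simps)
  then show "x \<in> (*\<^sub>R) c ` body h" using assms by (intro image_eqI[of _ _ "(1 / c) *\<^sub>R x"]) auto
qed (use assms in \<open>auto simp: body_def abs_mult intro!: mult_left_mono\<close>)

lemma symmetric_convex_body_body:
  assumes "\<forall>i<N. 0 < h i" shows "symmetric_convex_body (body h)"
proof (rule symmetric_convex_bodyI)
  have eq: "body h = (\<Inter>i<N. {x. u i \<bullet> x \<le> h i} \<inter> {x. u i \<bullet> x \<ge> - h i})"
    by (auto simp: body_def abs_le_iff) (metis lessThan_iff minus_le_iff)
  have "closed (body h)"
    unfolding eq by (intro closed_INT ballI closed_Int closed_halfspace_le closed_halfspace_ge)
  moreover have "bounded (body h)"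
  proof -
    define c where "c = 1 + (\<Sum>i<N. h i)"
    have nn: "0 \<le> (\<Sum>i<N. h i)" using assms by (intro sum_nonneg) auto
    have "h i \<le> c" if "i < N" for i
    proof -
      have "h i \<le> sum h {..<N}"
        by (rule member_le_sum) (use assms that in \<open>auto simp: less_imp_le\<close>)
      then show ?thesis by (simp add: c_def)
    qed
    then have "body h \<subseteq> body (\<lambda>i. c * 1)" by (force simp: body_def)
    also have "\<dots> = (*\<^sub>R) c ` body (\<lambda>i. 1)" using nn by (intro body_scale) (simp add: c_def)
    finally show ?thesis
      using bounded_unit by (auto simp: body_def intro: bounded_subset bounded_scaling)
  qed
  ultimately show "compact (body h)" by (simp add: compact_eq_bounded_closed)
  show "convex (body h)"
    unfolding eq by (intro convex_INT convex_Int convex_halfspace_le convex_halfspace_ge)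
  show "- x \<in> body h" if "x \<in> body h" for x using that by (auto simp: body_def)
  have "open (\<Inter>i<N. {x. \<bar>u i \<bullet> x\<bar> < h i})"
    by (intro open_INT ballI finite_lessThan open_Collect_less continuous_intros)
  moreover have "(\<Inter>i<N. {x. \<bar>u i \<bullet> x\<bar> < h i}) \<subseteq> body h" by (force simp: body_def)
  moreover have "0 \<in> (\<Inter>i<N. {x. \<bar>u i \<bullet> x\<bar> < h i})" using assms by auto
  ultimately show "interior (body h) \<noteq> {}" using interior_maximal by blast
qed

lemma rad_sq: "(rad h)\<^sup>2 = measure lebesgue (body h)"
  by (simp add: rad_def)

lemma rad_cong: "(\<And>i. i < N \<Longrightarrow> h i = k i) \<Longrightarrow> rad h = rad k"
  by (simp add: rad_def body_def)

lemma rad_scale: "0 < c \<Longrightarrow> rad (\<lambda>i. c * h i) = c * rad h"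
  by (simp add: rad_def body_scale measure_lebesgue_scaleR real_sqrt_mult)

lemma rad_mono:
  assumes "\<And>i. i < N \<Longrightarrow> h i \<le> k i" "\<forall>i<N. 0 < k i" "\<forall>i<N. 0 < h i"
  shows "rad h \<le> rad k"
  unfolding rad_def
proof (intro real_sqrt_le_mono measure_mono_fmeasurable)
  show "body h \<subseteq> body k" using assms(1) by (force simp: body_def)
  show "body k \<in> lmeasurable" "body h \<in> sets lebesgue"
    using symmetric_convex_body_body assms symmetric_convex_bodyD(1) lmeasurable_compact fmeasurableD by blast+
qed

lemma rad_pos:
  "\<forall>i<N. 0 < h i \<Longrightarrow> 0 < rad h"
  unfolding rad_def by (simp add: measure_symmetric_convex_body_pos symmetric_convex_body_body)

lemma rad_superadditive:
  assumes h: "\<forall>i<N. 0 < h i" and k: "\<forall>i<N. 0 < k i"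
  shows "rad h + rad k \<le> rad (\<lambda>i. h i + k i)"
proof -
  note H = symmetric_convex_body_body[OF h] and K = symmetric_convex_body_body[OF k]
  define a where "a = support_function (body h) (u 0)"
  define b where "b = support_function (body k) (u 0)"
  have ab: "a > 0" "b > 0"
    using support_function_pos[OF H] support_function_pos[OF K] nonzero N_pos by (auto simp: a_def b_def)
  have "compact (body (\<lambda>i. h i + k i))"
    by (rule symmetric_convex_bodyD(1)[OF symmetric_convex_body_body]) (use h k in \<open>auto intro: add_pos_pos\<close>)
  moreover have "x + y \<in> body (\<lambda>i. h i + k i)" if "x \<in> body h" "y \<in> body k" for x y
    using that by (auto simp: body_def inner_right_distrib intro: order_trans[OF abs_triangle_ineq] add_mono)
  ultimately have le: "(a + b) * ((rad h)\<^sup>2 / a + (rad k)\<^sup>2 / b) \<le> (rad (\<lambda>i. h i + k i))\<^sup>2"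
    unfolding rad_sq a_def b_def
    by (intro measure_sums_ge_same_direction[OF H K]) (use nonzero N_pos in auto)
  \<comment> \<open>The excess is a perfect square whatever \<open>a\<close> and \<open>b\<close>
    are, so any direction serves here; \<open>u 0\<close> is one that always exists.\<close>
  have "(a + b) * ((rad h)\<^sup>2 / a + (rad k)\<^sup>2 / b) - (rad h + rad k)\<^sup>2 = (b * rad h - a * rad k)\<^sup>2 / (a * b)"
    using ab by (simp add: field_simps power2_eq_square)
  then have "(rad h + rad k)\<^sup>2 \<le> (a + b) * ((rad h)\<^sup>2 / a + (rad k)\<^sup>2 / b)"
    using ab by (smt (verit) divide_nonneg_pos mult_pos_pos zero_le_power2)
  from order_trans[OF this le] show ?thesis
    by (rule power2_le_imp_le) (simp add: rad_def)
qed

text \<open>The coefficients act as edge lengths of \<open>body h\<close>. They are nonnegative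
  because widening a slab does not decrease the area, and they vanish on slabs whose boundary the
  body does not reach.\<close>

lemma rad_supergradient:
  assumes h: "\<forall>i<N. 0 < h i"
  obtains m where "\<And>y. \<forall>i<N. 0 < y i \<Longrightarrow> rad y \<le> (\<Sum>i<N. m i * y i)" "rad h = (\<Sum>i<N. m i * h i)"
    "\<And>i. i < N \<Longrightarrow> 0 \<le> m i"
    "\<And>i. i < N \<Longrightarrow> support_function (body h) (u i) \<noteq> h i \<Longrightarrow> m i = 0"
proof -
  obtain m where m: "\<And>y. \<forall>i<N. 0 < y i \<Longrightarrow> rad y \<le> (\<Sum>i<N. m i * y i)" "rad h = (\<Sum>i<N. m i * h i)"
    using supergradient_homogeneous[of N rad h] rad_superadditive rad_scale rad_cong h N_pos by blast
  have upd: "(\<Sum>i<N. m i * (h(j := c)) i) = rad h + m j * (c - h j)" if "j < N" for j c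
  proof -
    have "(\<Sum>i<N. m i * (h(j := c)) i) = (\<Sum>i<N. m i * h i + (if i = j then m j * (c - h j) else 0))"
      by (intro sum.cong) (auto simp: algebra_simps)
    then show ?thesis using that by (simp add: sum.distrib m(2))
  qed
  have nn: "0 \<le> m j" if j: "j < N" for j
  proof -
    have "rad h \<le> rad (h(j := h j + 1))" using h by (intro rad_mono) (auto intro: add_pos_pos)
    also have "\<dots> \<le> rad h + m j * (h j + 1 - h j)"
      unfolding upd[OF j, symmetric] using h by (intro m) (auto intro: add_pos_pos)
    finally show ?thesis by simp
  qed
  have "m j = 0" if j: "j < N" and ne: "support_function (body h) (u j) \<noteq> h j" for j
  proof -
    note H = symmetric_convex_body_body[OF h]
    \<comment> \<open>Replacing \<open>h j\<close> by the true width \<open>s\<close> leaves the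
      body unchanged, so the supergradient inequality gives \<open>0 \<le> m j * (s - h j)\<close>
      with a negative second factor.\<close>
    define s where "s = support_function (body h) (u j)"
    have "s \<le> h j" unfolding s_def
      using j symmetric_convex_bodyD(4)[OF H] by (intro support_function_le) (auto simp: body_def abs_le_iff)
    then have s: "s < h j" "0 < s" using ne support_function_pos[OF H nonzero[OF j]] by (auto simp: s_def)
    have "body h \<subseteq> body (h(j := s))"
      using abs_inner_le_support_function[OF H, of _ "u j"] by (auto simp: body_def s_def)
    moreover have "body (h(j := s)) \<subseteq> body h"
    proof
      fix x assume "x \<in> body (h(j := s))"
      then have "\<bar>u i \<bullet> x\<bar> \<le> (h(j := s)) i" if "i < N" for i
        using that by (simp add: body_def del: fun_upd_apply)
      moreover have "(h(j := s)) i \<le> h i" for i using s by simp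
      ultimately have "\<bar>u i \<bullet> x\<bar> \<le> h i" if "i < N" for i using that order_trans by blast
      then show "x \<in> body h" by (simp add: body_def)
    qed
    ultimately have "rad h = rad (h(j := s))" unfolding rad_def by (simp add: subset_antisym)
    also have "\<dots> \<le> rad h + m j * (s - h j)"
      unfolding upd[OF j, symmetric] using h s by (intro m) auto
    finally have "0 \<le> m j * (s - h j)" by simp
    then show ?thesis using s nn[OF j] by (simp add: zero_le_mult_iff)
  qed
  with m nn show ?thesis using that by blast
qed

text \<open>This is the coefficient of \<open>e\<close> in the area inequality for
  \<open>body h\<close> and \<open>e L\<close>. The supergradient bounds the growth of the enclosing
  slab body from above, and the touching slab \<open>j\<close> supplies the widths
  \<open>h j\<close> and \<open>e * g j\<close>.\<close>

lemma mixed_area_ge: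
  assumes h: "\<forall>i<N. 0 < h i" and L: "symmetric_convex_body L"
    and m: "\<And>y. \<forall>i<N. 0 < y i \<Longrightarrow> rad y \<le> (\<Sum>i<N. m i * y i)" "rad h = (\<Sum>i<N. m i * h i)"
    and j: "j < N" "support_function (body h) (u j) = h j"
  defines "g \<equiv> \<lambda>i. support_function L (u i)"
  shows "g j * (rad h)\<^sup>2 / h j + h j * measure lebesgue L / g j \<le> 2 * rad h * (\<Sum>i<N. m i * g i)"
proof -
  define M where "M = (\<Sum>i<N. m i * g i)"
  define X where "X = g j * (rad h)\<^sup>2 / h j + h j * measure lebesgue L / g j"
  have g: "g i > 0" if "i < N" for i using support_function_pos[OF L nonzero[OF that]] by (simp add: g_def)
  note H = symmetric_convex_body_body[OF h]
  \<comment> \<open>The terms of order zero cancel, the nonnegative term with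
    \<open>e\<^sup>2\<close> on the left is dropped, and a factor \<open>e\<close> is divided
    out.\<close>
  have bd: "X - 2 * rad h * M \<le> e * M\<^sup>2" if e: "e > 0" for e
  proof -
    have eL: "symmetric_convex_body ((*\<^sub>R) e ` L)" using L e by (rule symmetric_convex_body_scaleR)
    have se: "support_function ((*\<^sub>R) e ` L) (u i) = e * g i" for i
      unfolding g_def using symmetric_convex_bodyD[OF L] e by (intro support_function_scaleR) auto
    let ?k = "\<lambda>i. h i + e * g i"
    have k: "\<forall>i<N. 0 < ?k i" using h g e by (auto intro: add_pos_pos)
    have "x + y \<in> body ?k" if "x \<in> body h" "y \<in> (*\<^sub>R) e ` L" for x y
    proof -
      have "\<bar>u i \<bullet> (x + y)\<bar> \<le> ?k i" if "i < N" for i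
      proof -
        have "\<bar>u i \<bullet> x\<bar> \<le> h i" using \<open>x \<in> body h\<close> that by (auto simp: body_def)
        moreover have "\<bar>u i \<bullet> y\<bar> \<le> e * g i"
          using abs_inner_le_support_function[OF eL \<open>y \<in> _\<close>, of "u i"] se by simp
        ultimately show ?thesis by (simp add: inner_right_distrib)
      qed
      then show ?thesis by (simp add: body_def)
    qed
    from measure_sums_ge_same_direction[OF H eL symmetric_convex_bodyD(1)[OF symmetric_convex_body_body[OF k]] this nonzero[OF j(1)]]
    have "(h j + e * g j) * ((rad h)\<^sup>2 / h j + e\<^sup>2 * measure lebesgue L / (e * g j)) \<le> (rad ?k)\<^sup>2"
      using e by (simp add: se j rad_sq measure_lebesgue_scaleR)
    also have "\<dots> \<le> (rad h + e * M)\<^sup>2"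
    proof (rule power_mono)
      have "rad ?k \<le> (\<Sum>i<N. m i * ?k i)" by (rule m(1)[OF k])
      also have "\<dots> = rad h + e * M"
        by (simp add: m(2) M_def sum_distrib_left algebra_simps sum.distrib)
      finally show "rad ?k \<le> rad h + e * M" .
    qed (simp add: rad_def)
    also have "(h j + e * g j) * ((rad h)\<^sup>2 / h j + e\<^sup>2 * measure lebesgue L / (e * g j))
       = (rad h)\<^sup>2 + e * X + e\<^sup>2 * measure lebesgue L"
      using e h[rule_format, OF j(1)] g[OF j(1)] by (simp add: X_def field_simps power2_eq_square)
    finally have "e * (X - 2 * rad h * M) + e\<^sup>2 * measure lebesgue L \<le> e * (e * M\<^sup>2)"
      by (simp add: power2_eq_square algebra_simps)
    moreover have "0 \<le> e\<^sup>2 * measure lebesgue L" by simp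
    ultimately have "e * (X - 2 * rad h * M) \<le> e * (e * M\<^sup>2)" by linarith
    then show ?thesis using e by (simp add: mult_le_cancel_left_pos)
  qed
  have "X - 2 * rad h * M \<le> 0"
  proof (rule field_le_epsilon)
    fix d :: real assume "d > 0"
    \<comment> \<open>This value of \<open>e\<close> brings the error below \<open>d\<close>; the
      added 1 covers \<open>M = 0\<close>.\<close>
    have "d / (M\<^sup>2 + 1) * M\<^sup>2 \<le> d"
      using \<open>d > 0\<close> by (simp add: field_simps add_pos_nonneg)
    moreover have "0 < d / (M\<^sup>2 + 1)" using \<open>d > 0\<close> by (simp add: add_nonneg_pos)
    ultimately show "X - 2 * rad h * M \<le> 0 + d" using bd[of "d / (M\<^sup>2 + 1)"] by linarith
  qed
  then show ?thesis by (simp add: X_def M_def)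
qed

text \<open>The bounds of \<open>mixed_area_ge\<close> are added with the weights
  \<open>m j * h j\<close>, whose total is \<open>rad h\<close>. Slabs that the body does not touch
  have weight 0, so the missing bound does no harm.\<close>

lemma measure_mult_sum_le:
  assumes h: "\<forall>i<N. 0 < h i" and L: "symmetric_convex_body L"
    and m: "\<And>y. \<forall>i<N. 0 < y i \<Longrightarrow> rad y \<le> (\<Sum>i<N. m i * y i)" "rad h = (\<Sum>i<N. m i * h i)"
    "\<And>i. i < N \<Longrightarrow> 0 \<le> m i"
    "\<And>i. i < N \<Longrightarrow> support_function (body h) (u i) \<noteq> h i \<Longrightarrow> m i = 0"
  shows "measure lebesgue L * (\<Sum>i<N. m i * ((h i)\<^sup>2 / support_function L (u i)))
     \<le> (rad h)\<^sup>2 * (\<Sum>i<N. m i * support_function L (u i))"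
proof -
  define g where "g = (\<lambda>i. support_function L (u i))"
  define M where "M = (\<Sum>i<N. m i * g i)"
  have g: "g i > 0" if "i < N" for i using support_function_pos[OF L nonzero[OF that]] by (simp add: g_def)
  have "(rad h)\<^sup>2 * (m j * g j) + measure lebesgue L * (m j * ((h j)\<^sup>2 / g j)) \<le> 2 * rad h * M * (m j * h j)"
    if j: "j < N" for j
  proof (cases "m j = 0")
    case False
    then have "support_function (body h) (u j) = h j" using m(4) j by blast
    from mixed_area_ge[OF h L m(1,2) j this]
    have "g j * (rad h)\<^sup>2 / h j + h j * measure lebesgue L / g j \<le> 2 * rad h * M"
      by (simp add: g_def M_def)
    then have "(m j * h j) * (g j * (rad h)\<^sup>2 / h j + h j * measure lebesgue L / g j) \<le> (m j * h j) * (2 * rad h * M)"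
      using m(3)[OF j] h j by (intro mult_left_mono) (auto simp: less_imp_le)
    moreover have "(m j * h j) * (g j * (rad h)\<^sup>2 / h j + h j * measure lebesgue L / g j)
       = (rad h)\<^sup>2 * (m j * g j) + measure lebesgue L * (m j * ((h j)\<^sup>2 / g j))"
      using h[rule_format, OF j] by (simp add: field_simps power2_eq_square)
    ultimately show ?thesis by (simp add: mult_ac)
  qed simp
  then have "(\<Sum>j<N. (rad h)\<^sup>2 * (m j * g j) + measure lebesgue L * (m j * ((h j)\<^sup>2 / g j)))
     \<le> (\<Sum>j<N. 2 * rad h * M * (m j * h j))"
    by (intro sum_mono) auto
  then have "(rad h)\<^sup>2 * M + measure lebesgue L * (\<Sum>j<N. m j * ((h j)\<^sup>2 / g j)) \<le> 2 * rad h * M * rad h"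
    by (simp only: sum.distrib flip: sum_distrib_left) (simp add: M_def m(2))
  also have "2 * rad h * M * rad h = 2 * ((rad h)\<^sup>2 * M)" by (simp add: power2_eq_square)
  finally show ?thesis by (simp add: g_def M_def)
qed

lemma measure_mult_le_body:
  assumes h: "\<forall>i<N. 0 < h i" and K: "symmetric_convex_body K" and L: "symmetric_convex_body L"
    and le: "\<And>i. i < N \<Longrightarrow> support_function K (u i) * support_function L (u i) \<le> (h i)\<^sup>2"
  shows "measure lebesgue K * measure lebesgue L \<le> (measure lebesgue (body h))\<^sup>2"
proof -
  obtain m where m: "\<And>y. \<forall>i<N. 0 < y i \<Longrightarrow> rad y \<le> (\<Sum>i<N. m i * y i)" "rad h = (\<Sum>i<N. m i * h i)"
    "\<And>i. i < N \<Longrightarrow> 0 \<le> m i"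
    "\<And>i. i < N \<Longrightarrow> support_function (body h) (u i) \<noteq> h i \<Longrightarrow> m i = 0"
    using rad_supergradient[OF h] by blast
  \<comment> \<open>Up to a factor this is an upper bound for a mixed area with
    \<open>body h\<close>. It is positive, since \<open>rad h > 0\<close> rules out that all
    \<open>m i\<close> vanish, and can therefore be cancelled at the end.\<close>
  define S where "S = (\<lambda>C. \<Sum>i<N. m i * support_function C (u i))"
  have Spos: "0 < S C" if C: "symmetric_convex_body C" for C
  proof -
    have pos: "0 < support_function C (u i)" if "i < N" for i using support_function_pos[OF C nonzero[OF that]] .
    have "\<exists>i<N. m i \<noteq> 0"
    proof (rule ccontr)
      assume "\<not> (\<exists>i<N. m i \<noteq> 0)"
      then have "rad h = 0" by (simp add: m(2))
      then show False using rad_pos[OF h] by simp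
    qed
    then obtain i where i: "i < N" "m i \<noteq> 0" by blast
    then have "m i > 0" using m(3)[of i] by simp
    note i = i this
    show ?thesis unfolding S_def
      by (rule sum_pos2[of _ i]) (use i pos m(3) in \<open>auto simp: less_imp_le\<close>)
  qed
  have one: "measure lebesgue C * S D \<le> (rad h)\<^sup>2 * S C"
    if C: "symmetric_convex_body C" and D: "symmetric_convex_body D"
      and CD: "\<And>i. i < N \<Longrightarrow> support_function C (u i) * support_function D (u i) \<le> (h i)\<^sup>2" for C D
  proof -
    \<comment> \<open>The condition on the product of the support functions says exactly that the
      support function of \<open>D\<close> is at most \<open>(h i)\<^sup>2\<close> over that of
      \<open>C\<close>. Used for both orders of \<open>K\<close> and \<open>L\<close>, it makes the
      two estimates fit together.\<close>
    have "S D \<le> (\<Sum>i<N. m i * ((h i)\<^sup>2 / support_function C (u i)))"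
      unfolding S_def
    proof (intro sum_mono mult_left_mono)
      fix i assume "i \<in> {..<N}"
      then show "support_function D (u i) \<le> (h i)\<^sup>2 / support_function C (u i)" "0 \<le> m i"
        using CD[of i] support_function_pos[OF C nonzero[of i]] m(3) by (auto simp: field_simps)
    qed
    then have "measure lebesgue C * S D \<le> measure lebesgue C * (\<Sum>i<N. m i * ((h i)\<^sup>2 / support_function C (u i)))"
      by (intro mult_left_mono) auto
    also have "\<dots> \<le> (rad h)\<^sup>2 * S C" unfolding S_def by (rule measure_mult_sum_le[OF h C m])
    finally show ?thesis .
  qed
  have "(measure lebesgue K * S L) * (measure lebesgue L * S K) \<le> ((rad h)\<^sup>2 * S K) * ((rad h)\<^sup>2 * S L)"
  proof (rule mult_mono)
    show "measure lebesgue L * S K \<le> (rad h)\<^sup>2 * S L"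
      using one[OF L K] le by (simp add: mult.commute)
  qed (use one[OF K L le] Spos[OF K] Spos[OF L] in \<open>simp_all add: less_imp_le\<close>)
  then have "(S K * S L) * (measure lebesgue K * measure lebesgue L) \<le> (S K * S L) * ((rad h)\<^sup>2)\<^sup>2"
    by (simp add: algebra_simps power2_eq_square)
  then show ?thesis using Spos[OF K] Spos[OF L] by (simp add: rad_sq mult_le_cancel_left_pos)
qed

end

subsection \<open>The planar log-Brunn-Minkowski inequality\<close>

lemma support_function_pos_unit:
  assumes "symmetric_convex_body K" "norm u = 1" shows "0 < support_function K u"
  using assms by (intro support_function_pos) auto

lemma support_function_uminus:
  assumes "symmetric_convex_body K" shows "support_function K (- u) = support_function K u"
proof -
  note K = symmetric_convex_bodyD[OF assms]
  have "support_function K (- v) \<le> support_function K v" for v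
    using abs_inner_le_support_function[OF assms, of _ v] K(4) by (intro support_function_le) (auto simp: abs_le_iff)
  from this[of u] this[of "- u"] show ?thesis by simp
qed

lemma support_function_le_radius:
  fixes K :: "'a::euclidean_space set"
  assumes "compact K" "K \<noteq> {}"
  obtains R where "R > 0" "\<And>u. support_function K u \<le> R * norm u" "\<And>x. x \<in> K \<Longrightarrow> norm x \<le> R"
proof -
  obtain R where R: "R > 0" "\<And>x. x \<in> K \<Longrightarrow> norm x \<le> R"
    using compact_imp_bounded[OF assms(1)] bounded_pos by metis
  have "support_function K u \<le> R * norm u" for u
  proof (rule support_function_le[OF assms(2)])
    fix x assume "x \<in> K"
    have "u \<bullet> x \<le> norm u * norm x" by (rule norm_cauchy_schwarz)
    also have "\<dots> \<le> norm u * R" using R(2)[OF \<open>x \<in> K\<close>] by (intro mult_left_mono) auto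
    finally show "u \<bullet> x \<le> R * norm u" by (simp add: mult.commute)
  qed
  with R that show ?thesis by blast
qed

lemma continuous_on_support_function:
  fixes K :: "'a::euclidean_space set"
  assumes "compact K" "K \<noteq> {}" shows "continuous_on S (support_function K)"
proof -
  obtain R where R: "R > 0" "\<And>x. x \<in> K \<Longrightarrow> norm x \<le> R"
    using support_function_le_radius[OF assms] by metis
  have le: "support_function K u \<le> support_function K v + R * norm (u - v)" for u v
  proof (rule support_function_le[OF assms(2)])
    fix x assume x: "x \<in> K"
    have "(u - v) \<bullet> x \<le> norm (u - v) * norm x" by (rule norm_cauchy_schwarz)
    also have "\<dots> \<le> norm (u - v) * R" using R(2)[OF x] by (intro mult_left_mono) auto
    finally show "u \<bullet> x \<le> support_function K v + R * norm (u - v)"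
      using inner_le_support_function[OF assms(1) x, of v] by (simp add: inner_diff_left mult.commute)
  qed
  have "R-lipschitz_on S (support_function K)"
  proof (rule lipschitz_onI)
    fix u v show "dist (support_function K u) (support_function K v) \<le> R * dist u v"
      using le[of u v] le[of v u] by (simp add: dist_norm norm_minus_commute abs_le_iff)
  qed (use R in simp)
  then show ?thesis by (rule lipschitz_on_continuous_on)
qed

text \<open>Inner and outer radii of \<open>K\<close> and \<open>L\<close> bound the right-hand
  sides of the constraints between two positive constants, which gives interior and compactness. The
  endpoints 0 and 1 of \<open>lam\<close> are included because the concavity argument starts from
  them.\<close>

lemma log_sum_symmetric_convex_body:
  assumes K: "symmetric_convex_body K" and L: "symmetric_convex_body L" and lam: "0 \<le> lam" "lam \<le> 1"
  shows "symmetric_convex_body (log_sum lam K L)"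
proof (rule symmetric_convex_bodyI)
  define h where "h = (\<lambda>u. support_function K u powr lam * support_function L u powr (1 - lam))"
  have eq: "log_sum lam K L = (\<Inter>u\<in>sphere 0 1. {x. u \<bullet> x \<le> h u})"
    by (auto simp: log_sum_def h_def inner_commute)
  have mem: "x \<in> log_sum lam K L \<longleftrightarrow> (\<forall>u. norm u = 1 \<longrightarrow> u \<bullet> x \<le> h u)" for x
    by (auto simp: eq)
  have "closed (log_sum lam K L)"
    unfolding eq by (intro closed_INT ballI closed_halfspace_le)
  note KD = symmetric_convex_bodyD[OF K] and LD = symmetric_convex_bodyD[OF L]
  obtain R1 where R1: "R1 > 0" "\<And>u. support_function K u \<le> R1 * norm u" using support_function_le_radius[OF KD(1,4)] by metis
  obtain R2 where R2: "R2 > 0" "\<And>u. support_function L u \<le> R2 * norm u" using support_function_le_radius[OF LD(1,4)] by metis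
  obtain r1 where r1: "r1 > 0" "\<And>u. r1 * norm u \<le> support_function K u" using support_function_ge_radius[OF K] by metis
  obtain r2 where r2: "r2 > 0" "\<And>u. r2 * norm u \<le> support_function L u" using support_function_ge_radius[OF L] by metis
  have h_le: "h u \<le> R1 powr lam * R2 powr (1 - lam)" if "norm u = 1" for u
  proof -
    have "0 \<le> support_function K u" "0 \<le> support_function L u"
      using r1(1) r1(2)[of u] r2(1) r2(2)[of u] that by auto
    then show ?thesis unfolding h_def
      using R1(2)[of u] R2(2)[of u] that lam by (intro mult_mono powr_mono2) auto
  qed
  have h_ge: "r1 powr lam * r2 powr (1 - lam) \<le> h u" if "norm u = 1" for u
    unfolding h_def using r1(1) r1(2)[of u] r2(1) r2(2)[of u] that lam by (intro mult_mono powr_mono2) auto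
  have "norm x \<le> R1 powr lam * R2 powr (1 - lam)" if "x \<in> log_sum lam K L" for x
  proof (cases "x = 0")
    case False
    then have n: "norm ((1 / norm x) *\<^sub>R x) = 1" by simp
    with that have "((1 / norm x) *\<^sub>R x) \<bullet> x \<le> h ((1 / norm x) *\<^sub>R x)" unfolding mem by blast
    also note h_le[OF n]
    finally show ?thesis using False by (simp add: dot_square_norm power2_eq_square)
  qed (use R1 R2 in auto)
  then have "bounded (log_sum lam K L)" by (auto simp: bounded_iff)
  with \<open>closed _\<close> show "compact (log_sum lam K L)" by (simp add: compact_eq_bounded_closed)
  show "convex (log_sum lam K L)" unfolding eq by (intro convex_INT convex_halfspace_le)
  have h_sym: "h (- u) = h u" for u by (simp add: h_def support_function_uminus K L)
  show "- x \<in> log_sum lam K L" if x: "x \<in> log_sum lam K L" for x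
  proof -
    have "u \<bullet> (- x) \<le> h u" if "norm u = 1" for u
    proof -
      have "(- u) \<bullet> x \<le> h (- u)" using x that unfolding mem by (metis norm_minus_cancel)
      then show ?thesis by (simp add: h_sym)
    qed
    then show ?thesis by (simp add: mem)
  qed
  define r where "r = r1 powr lam * r2 powr (1 - lam)"
  have "r > 0" using r1 r2 by (simp add: r_def)
  have "ball 0 r \<subseteq> log_sum lam K L"
  proof
    fix x :: 'a assume x: "x \<in> ball 0 r"
    have "u \<bullet> x \<le> h u" if u: "norm u = 1" for u
      using norm_cauchy_schwarz[of u x] x u h_ge[OF u] by (simp add: r_def)
    then show "x \<in> log_sum lam K L" by (simp add: eq)
  qed
  moreover have "0 \<in> ball (0::'a) r" using \<open>r > 0\<close> by simp
  ultimately show "interior (log_sum lam K L) \<noteq> {}"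
    using interior_maximal[OF _ open_ball] by blast
qed

lemma support_function_log_sum_le:
  assumes K: "symmetric_convex_body K" and L: "symmetric_convex_body L" and lam: "0 \<le> lam" "lam \<le> 1"
    and "norm u = 1"
  shows "support_function (log_sum lam K L) u \<le> support_function K u powr lam * support_function L u powr (1 - lam)"
  using symmetric_convex_bodyD(4)[OF log_sum_symmetric_convex_body[OF K L lam]] assms(5)
  by (intro support_function_le) (auto simp: log_sum_def inner_commute)

lemma log_sum_half_measure:
  fixes K L :: "(real^2) set"
  assumes K: "symmetric_convex_body K" and L: "symmetric_convex_body L"
  shows "measure lebesgue K * measure lebesgue L \<le> (measure lebesgue (log_sum (1/2) K L))\<^sup>2"
proof -
  obtain D :: "(real^2) set" where D: "countable D" "D \<subseteq> sphere 0 1" "sphere 0 1 \<subseteq> closure D"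
    using separable by blast
  have ax: "axis i 1 \<in> sphere (0::real^2) 1" for i by (simp add: norm_axis_1)
  then have "D \<noteq> {}" using D(3) by auto
  \<comment> \<open>The two coordinate axes come first, so every system with \<open>n + 2\<close>
    directions is bounded. The dense sequence follows with its index shifted by 2.\<close>
  define u where "u n = (if n = 0 then axis 1 1 else if n = 1 then axis 2 1 else from_nat_into D (n - 2))" for n :: nat
  have u1: "norm (u n) = 1" for n
    using from_nat_into[OF \<open>D \<noteq> {}\<close>, of "n - 2"] D(2) ax by (auto simp: u_def)
  have slab: "slab_system (n + 2) u" for n
  proof
    have "{x. \<forall>i<n + 2. \<bar>u i \<bullet> x\<bar> \<le> 1} \<subseteq> cbox (-1) 1"
    proof
      fix x assume x: "x \<in> {x. \<forall>i<n + 2. \<bar>u i \<bullet> x\<bar> \<le> 1}"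
      from x[simplified, THEN spec, of 0] x[simplified, THEN spec, of 1]
      show "x \<in> cbox (-1) 1" by (auto simp: u_def mem_box_cart forall_2 inner_axis' abs_le_iff)
    qed
    then show "bounded {x. \<forall>i<n + 2. \<bar>u i \<bullet> x\<bar> \<le> 1}" using bounded_cbox bounded_subset by blast
    show "u i \<noteq> 0" for i using u1[of i] by auto
  qed simp
  define g where "g v = sqrt (support_function K v * support_function L v)" for v
  have pos: "0 < support_function K v" "0 < support_function L v" if "norm v = 1" for v
    using that by (simp_all add: support_function_pos_unit K L)
  have gpos: "0 < g v" if "norm v = 1" for v
    using pos[OF that] by (simp add: g_def)
  have g_half: "support_function K v powr (1/2) * support_function L v powr (1 - 1/2) = g v" if "norm v = 1" for v
    using pos[OF that] by (simp add: g_def powr_half_sqrt real_sqrt_mult)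
  have g_cont: "continuous_on UNIV g"
    unfolding g_def using symmetric_convex_bodyD[OF K] symmetric_convex_bodyD[OF L]
    by (intro continuous_intros continuous_on_support_function)
  define B where "B n = slab_system.body (n + 2) u (\<lambda>i. g (u i))" for n
  have B_eq: "B n = {x. \<forall>i<n + 2. \<bar>u i \<bullet> x\<bar> \<le> g (u i)}" for n
    unfolding B_def by (rule slab_system.body_def[OF slab])
  have B_body: "symmetric_convex_body (B n)" for n
    unfolding B_def using gpos u1 by (intro slab_system.symmetric_convex_body_body[OF slab]) auto
  have le: "measure lebesgue K * measure lebesgue L \<le> (measure lebesgue (B n))\<^sup>2" for n
    unfolding B_def
  proof (rule slab_system.measure_mult_le_body[OF slab _ K L])
    show "\<forall>i<n + 2. 0 < g (u i)" using gpos u1 by auto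
    show "support_function K (u i) * support_function L (u i) \<le> (g (u i))\<^sup>2" for i
      using pos[OF u1[of i]] by (simp add: g_def)
  qed
  have "(\<Inter>n. B n) = log_sum (1/2) K L"
  proof (intro equalityI subsetI)
    fix x assume x: "x \<in> (\<Inter>n. B n)"
    have d: "v \<bullet> x \<le> g v" if v: "v \<in> D" for v
    proof -
      obtain n where n: "v = from_nat_into D n" using from_nat_into_surj[OF D(1) v] by metis
      then have "u (n + 2) = v" by (simp add: u_def)
      moreover have "\<bar>u (n + 2) \<bullet> x\<bar> \<le> g (u (n + 2))"
        using x unfolding B_eq by (metis (mono_tags, lifting) INT_D UNIV_I lessI mem_Collect_eq add_Suc_right add_2_eq_Suc' less_Suc_eq)
      ultimately show ?thesis by simp
    qed
    \<comment> \<open>Continuity of \<open>g\<close> carries the constraints from the dense set to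
      the whole circle, so the slab bodies decrease exactly to the logarithmic sum.\<close>
    have "closed {v. v \<bullet> x \<le> g v}" using g_cont by (intro closed_Collect_le continuous_intros)
    then have "closure D \<subseteq> {v. v \<bullet> x \<le> g v}" using d by (intro closure_minimal) auto
    then show "x \<in> log_sum (1/2) K L"
      using D(3) g_half by (auto simp: log_sum_def inner_commute)
  next
    fix x assume x: "x \<in> log_sum (1/2) K L"
    have "\<bar>v \<bullet> x\<bar> \<le> g v" if "norm v = 1" for v
    proof -
      have "w \<bullet> x \<le> g w" if "norm w = 1" for w
      proof -
        have "x \<bullet> w \<le> support_function K w powr (1/2) * support_function L w powr (1 - 1/2)"
          using x that unfolding log_sum_def by simp
        then show ?thesis by (simp only: g_half[OF that] inner_commute)
      qed
      from this[of v] this[of "- v"] that show ?thesis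
        by (simp add: g_def support_function_uminus K L abs_le_iff)
    qed
    then show "x \<in> (\<Inter>n. B n)" using u1 by (auto simp: B_eq)
  qed
  moreover have "(\<lambda>n. measure lebesgue (B n)) \<longlonglongrightarrow> measure lebesgue (\<Inter>n. B n)"
  proof (rule Lim_measure_decseq)
    have "B i \<in> lmeasurable" for i
      by (rule lmeasurable_compact[OF symmetric_convex_bodyD(1)[OF B_body]])
    then show "range B \<subseteq> sets lebesgue" "emeasure lebesgue (B i) \<noteq> \<infinity>" for i
      unfolding infinity_ennreal_def by (blast intro: fmeasurableD, blast dest: fmeasurableD2)
    show "decseq B" by (auto simp: decseq_def B_eq)
  qed
  ultimately have "(\<lambda>n. (measure lebesgue (B n))\<^sup>2) \<longlonglongrightarrow> (measure lebesgue (log_sum (1/2) K L))\<^sup>2"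
    by (intro tendsto_power) simp
  then show ?thesis by (rule LIMSEQ_le_const) (use le in auto)
qed

lemma midpoint_concave_unit_interval:
  fixes \<phi> :: "real \<Rightarrow> real"
  assumes cont: "continuous_on {0..1} \<phi>"
    and mid: "\<And>x y. x \<in> {0..1} \<Longrightarrow> y \<in> {0..1} \<Longrightarrow> (\<phi> x + \<phi> y) / 2 \<le> \<phi> ((x + y) / 2)"
    and t: "t \<in> {0..1}"
  shows "(1 - t) * \<phi> 0 + t * \<phi> 1 \<le> \<phi> t"
proof (rule ccontr)
  \<comment> \<open>Subtracting the chord keeps the midpoint inequality and makes both end values
    zero, so a negative minimum lies strictly inside.\<close>
  define \<psi> where "\<psi> s = \<phi> s - ((1 - s) * \<phi> 0 + s * \<phi> 1)" for s
  assume "\<not> ?thesis"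
  then have neg: "\<psi> t < 0" by (simp add: \<psi>_def)
  have c: "continuous_on {0..1} \<psi>" unfolding \<psi>_def by (intro continuous_intros cont)
  have pmid: "(\<psi> x + \<psi> y) / 2 \<le> \<psi> ((x + y) / 2)" if "x \<in> {0..1}" "y \<in> {0..1}" for x y
    using mid[OF that] by (simp add: \<psi>_def field_simps)
  obtain x where x: "x \<in> {0..1}" "\<And>y. y \<in> {0..1} \<Longrightarrow> \<psi> x \<le> \<psi> y"
    using continuous_attains_inf[OF _ _ c] by auto
  \<comment> \<open>At the leftmost minimum point the midpoint inequality is strictly violated.\<close>
  define S where "S = {s \<in> {0..1}. \<psi> s \<le> \<psi> x}"
  have "compact S"
    using continuous_on_closed_Collect_le[OF c continuous_on_const, of "\<psi> x"]
    by (auto simp: S_def compact_eq_bounded_closed intro: bounded_subset[of "{0..1}"])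
  moreover have "x \<in> S" using x by (simp add: S_def)
  ultimately obtain z where z: "z \<in> S" "\<And>y. y \<in> S \<Longrightarrow> z \<le> y"
    using compact_attains_inf[of S] by blast
  have "\<psi> z < 0" using z(1) x(2)[OF t] neg by (simp add: S_def)
  moreover have "\<psi> 0 = 0" "\<psi> 1 = 0" by (simp_all add: \<psi>_def)
  ultimately have z01: "0 < z" "z < 1" using z(1) by (auto simp: S_def less_le)
  \<comment> \<open>The largest step for which both \<open>z - d\<close> and \<open>z + d\<close>
    stay in the interval.\<close>
  define d where "d = min z (1 - z)"
  have d: "0 < d" "z - d \<in> {0..1}" "z + d \<in> {0..1}" using z01 by (auto simp: d_def)
  have "z - d \<notin> S" using z(2)[of "z - d"] d by auto
  then have "\<psi> (z - d) > \<psi> x" using d by (simp add: S_def)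
  moreover have "\<psi> (z + d) \<ge> \<psi> x" using d x by auto
  moreover have "\<psi> z \<le> \<psi> x" using z by (simp add: S_def)
  ultimately show False using pmid[OF d(2,3)] by simp
qed

text \<open>The logarithm of the area of \<open>log_sum t K L\<close> is Lipschitz and midpoint
  concave in \<open>t\<close>, hence lies above its chord.\<close>

lemma log_brunn_minkowski_plane:
  fixes K L :: "(real^2) set"
  assumes K: "symmetric_convex_body K" and L: "symmetric_convex_body L" and lam: "0 \<le> lam" "lam \<le> 1"
  shows "measure lebesgue K powr lam * measure lebesgue L powr (1 - lam) \<le> measure lebesgue (log_sum lam K L)"
proof -
  define h where "h t u = support_function K u powr t * support_function L u powr (1 - t)" for t u
  define W where "W t = measure lebesgue (log_sum t K L)" for t
  note KD = symmetric_convex_bodyD[OF K] and LD = symmetric_convex_bodyD[OF L]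
  have sK: "0 < support_function K u" and sL: "0 < support_function L u" if "norm u = 1" for u
    using that by (simp_all add: support_function_pos_unit K L)
  have body: "symmetric_convex_body (log_sum t K L)" if "t \<in> {0..1}" for t
    using that by (intro log_sum_symmetric_convex_body K L) auto
  have lm: "log_sum t K L \<in> lmeasurable" if "t \<in> {0..1}" for t
    using symmetric_convex_bodyD(1)[OF body[OF that]] by (rule lmeasurable_compact)
  have Wpos: "0 < W t" if "t \<in> {0..1}" for t
    unfolding W_def by (rule measure_symmetric_convex_body_pos[OF body[OF that]])
  obtain R1 where R1: "R1 > 0" "\<And>u. support_function K u \<le> R1 * norm u" using support_function_le_radius[OF KD(1,4)] by metis
  obtain R2 where R2: "R2 > 0" "\<And>u. support_function L u \<le> R2 * norm u" using support_function_le_radius[OF LD(1,4)] by metis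
  obtain r1 where r1: "r1 > 0" "\<And>u. r1 * norm u \<le> support_function K u" using support_function_ge_radius[OF K] by metis
  obtain r2 where r2: "r2 > 0" "\<And>u. r2 * norm u \<le> support_function L u" using support_function_ge_radius[OF L] by metis
  \<comment> \<open>A crude bound for the difference of the logarithms of the two support functions
    on the unit circle, that is, for the rate at which the constraints change with
    \<open>t\<close>.\<close>
  define c where "c = \<bar>ln R1\<bar> + \<bar>ln R2\<bar> + \<bar>ln r1\<bar> + \<bar>ln r2\<bar>"
  have "c \<ge> 0" by (simp add: c_def)
  have lnK: "ln r1 \<le> ln (support_function K u)" "ln (support_function K u) \<le> ln R1" if "norm u = 1" for u
    using r1(1) r1(2)[of u] R1(2)[of u] sK[OF that] R1(1) that by simp_all
  have lnL: "ln r2 \<le> ln (support_function L u)" "ln (support_function L u) \<le> ln R2" if "norm u = 1" for u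
    using r2(1) r2(2)[of u] R2(2)[of u] sL[OF that] R2(1) that by simp_all
  have h_exp: "h t u = exp (t * ln (support_function K u) + (1 - t) * ln (support_function L u))" if "norm u = 1" for t u
    using sK[OF that] sL[OF that] by (simp add: h_def powr_def exp_add)
  have hlip: "h s u \<le> exp (c * \<bar>s - t\<bar>) * h t u" if u: "norm u = 1" for s t u
  proof -
    let ?k = "ln (support_function K u)" and ?l = "ln (support_function L u)"
    have "(s - t) * (?k - ?l) \<le> \<bar>s - t\<bar> * \<bar>?k - ?l\<bar>" by (metis abs_ge_self abs_mult)
    also have "\<dots> \<le> \<bar>s - t\<bar> * c"
      using lnK[OF u] lnL[OF u] by (intro mult_left_mono) (auto simp: c_def)
    finally have "s * ?k + (1 - s) * ?l \<le> c * \<bar>s - t\<bar> + (t * ?k + (1 - t) * ?l)"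
      by (simp add: algebra_simps)
    then show ?thesis unfolding h_exp[OF u] by (simp flip: exp_add)
  qed
  \<comment> \<open>A dilation by the factor from \<open>hlip\<close> absorbs the change of
    \<open>t\<close>; the 2 is the dimension of the plane.\<close>
  have Wlip: "ln (W s) \<le> ln (W t) + 2 * c * \<bar>s - t\<bar>" if st: "s \<in> {0..1}" "t \<in> {0..1}" for s t
  proof -
    let ?e = "exp (c * \<bar>s - t\<bar>)"
    have "log_sum s K L \<subseteq> (*\<^sub>R) ?e ` log_sum t K L"
    proof
      fix x assume x: "x \<in> log_sum s K L"
      have "(1 / ?e) *\<^sub>R x \<in> log_sum t K L"
        unfolding log_sum_def
      proof (intro CollectI ballI)
        fix u :: "real^2" assume "u \<in> sphere 0 1"
        then have u: "norm u = 1" by simp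
        have "x \<bullet> u \<le> h s u" using x u by (simp add: log_sum_def h_def)
        also note hlip[OF u, of s t]
        finally have "(1 / ?e) * (x \<bullet> u) \<le> h t u" by (simp add: field_simps)
        then show "(1 / ?e) *\<^sub>R x \<bullet> u \<le> support_function K u powr t * support_function L u powr (1 - t)"
          by (simp add: h_def)
      qed
      then show "x \<in> (*\<^sub>R) ?e ` log_sum t K L" by (intro image_eqI[of _ _ "(1 / ?e) *\<^sub>R x"]) auto
    qed
    then have "W s \<le> measure lebesgue ((*\<^sub>R) ?e ` log_sum t K L)"
      unfolding W_def using lm[OF st(1)] symmetric_convex_bodyD(1)[OF body[OF st(2)]]
      by (intro measure_mono_fmeasurable lmeasurable_compact compact_scaling) auto
    also have "\<dots> = exp (2 * (c * \<bar>s - t\<bar>)) * W t"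
      by (simp add: measure_lebesgue_scaleR W_def exp_double)
    finally have "ln (W s) \<le> ln (exp (2 * (c * \<bar>s - t\<bar>)) * W t)"
      using Wpos[OF st(1)] by (subst ln_le_cancel_iff) (use Wpos[OF st(2)] in auto)
    also have "\<dots> = 2 * (c * \<bar>s - t\<bar>) + ln (W t)"
      using Wpos[OF st(2)] by (simp add: ln_mult)
    finally show ?thesis by simp
  qed
  have "(2 * c)-lipschitz_on {0..1} (\<lambda>t. ln (W t))"
  proof (rule lipschitz_onI)
    fix s t :: real assume "s \<in> {0..1}" "t \<in> {0..1}"
    then show "dist (ln (W s)) (ln (W t)) \<le> 2 * c * dist s t"
      using Wlip[of s t] Wlip[of t s] by (simp add: dist_real_def abs_le_iff abs_minus_commute)
  qed (use \<open>c \<ge> 0\<close> in simp)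
  then have cont: "continuous_on {0..1} (\<lambda>t. ln (W t))" by (rule lipschitz_on_continuous_on)
  have mid: "(ln (W s) + ln (W t)) / 2 \<le> ln (W ((s + t) / 2))" if st: "s \<in> {0..1}" "t \<in> {0..1}" for s t
  proof -
    let ?A = "log_sum s K L" and ?B = "log_sum t K L" and ?m = "(s + t) / 2"
    have m: "?m \<in> {0..1}" using st by auto
    \<comment> \<open>The support function of a logarithmic sum may be smaller than the bound that
      defines it. Only this direction is used, and the geometric mean of the bounds for
      \<open>s\<close> and \<open>t\<close> is the bound for the midpoint.\<close>
    have "log_sum (1/2) ?A ?B \<subseteq> log_sum ?m K L"
    proof
      fix x assume x: "x \<in> log_sum (1/2) ?A ?B"
      show "x \<in> log_sum ?m K L" unfolding log_sum_def
      proof (intro CollectI ballI)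
        fix u :: "real^2" assume "u \<in> sphere 0 1"
        then have u: "norm u = 1" by simp
        then have u0: "u \<noteq> 0" by auto
        have "x \<bullet> u \<le> support_function ?A u powr (1/2) * support_function ?B u powr (1 - 1/2)"
          using x u by (simp add: log_sum_def)
        also have "\<dots> \<le> h s u powr (1/2) * h t u powr (1 - 1/2)"
          using support_function_log_sum_le[OF K L _ _ u, of s] support_function_log_sum_le[OF K L _ _ u, of t] st
            support_function_pos[OF body[OF st(1)] u0] support_function_pos[OF body[OF st(2)] u0]
          unfolding h_def by (intro mult_mono powr_mono2) auto
        also have "\<dots> = h ?m u"
          unfolding h_exp[OF u] by (simp add: powr_def field_simps flip: exp_add)
        finally show "x \<bullet> u \<le> support_function K u powr ?m * support_function L u powr (1 - ?m)"
          by (simp add: h_def)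
      qed
    qed
    then have le: "measure lebesgue (log_sum (1/2) ?A ?B) \<le> W ?m"
      unfolding W_def using log_sum_symmetric_convex_body[OF body[OF st(1)] body[OF st(2)], of "1/2"] lm[OF m]
      by (intro measure_mono_fmeasurable) (auto intro!: fmeasurableD lmeasurable_compact dest: symmetric_convex_bodyD(1))
    have "W s * W t \<le> (measure lebesgue (log_sum (1/2) ?A ?B))\<^sup>2"
      unfolding W_def by (rule log_sum_half_measure[OF body[OF st(1)] body[OF st(2)]])
    also have "\<dots> \<le> (W ?m)\<^sup>2" using le by (intro power_mono) auto
    finally have "ln (W s * W t) \<le> ln ((W ?m)\<^sup>2)"
      using Wpos[OF st(1)] Wpos[OF st(2)] Wpos[OF m] by (subst ln_le_cancel_iff) simp_all
    then show ?thesis using Wpos[OF st(1)] Wpos[OF st(2)] Wpos[OF m] by (simp add: ln_mult ln_realpow)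
  qed
  have "(1 - lam) * ln (W 0) + lam * ln (W 1) \<le> ln (W lam)"
    by (rule midpoint_concave_unit_interval[OF cont mid]) (use lam in auto)
  moreover have "ln (measure lebesgue K) \<le> ln (W 1)"
  proof -
    \<comment> \<open>In HOL \<open>0 powr 0 = 0\<close>, so positivity of the support functions is
      what makes the factor with exponent 0 equal to 1.\<close>
    have "K \<subseteq> log_sum 1 K L"
      using inner_le_support_function[OF KD(1)] sK sL
      by (force simp: log_sum_def inner_commute powr_one powr_zero_eq_one dest: less_imp_neq)
    then have "measure lebesgue K \<le> W 1"
      unfolding W_def using lm[of 1] lmeasurable_compact[OF KD(1)] by (intro measure_mono_fmeasurable) auto
    then show ?thesis using measure_symmetric_convex_body_pos[OF K] by simp
  qed
  moreover have "ln (measure lebesgue L) \<le> ln (W 0)"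
  proof -
    have "L \<subseteq> log_sum 0 K L"
      using inner_le_support_function[OF LD(1)] sK sL
      by (force simp: log_sum_def inner_commute powr_one powr_zero_eq_one dest: less_imp_neq)
    then have "measure lebesgue L \<le> W 0"
      unfolding W_def using lm[of 0] lmeasurable_compact[OF LD(1)] by (intro measure_mono_fmeasurable) auto
    then show ?thesis using measure_symmetric_convex_body_pos[OF L] by simp
  qed
  ultimately have "lam * ln (measure lebesgue K) + (1 - lam) * ln (measure lebesgue L) \<le> ln (W lam)"
    using lam by (smt (verit) mult_left_mono)
  then have "exp (lam * ln (measure lebesgue K) + (1 - lam) * ln (measure lebesgue L)) \<le> exp (ln (W lam))" by simp
  then show ?thesis
    using measure_symmetric_convex_body_pos[OF K] measure_symmetric_convex_body_pos[OF L] Wpos[of lam] lam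
    by (simp add: powr_def exp_add W_def)
qed

subsection \<open>The Prekopa-Leindler inequality on the line\<close>

lemma compact_exhaustion_lebesgue:
  fixes A :: "real set"
  assumes "A \<in> sets lebesgue" "A \<noteq> {}"
  obtains K :: "nat \<Rightarrow> real set" where "\<And>n. compact (K n)" "\<And>n. K n \<noteq> {}" "\<And>n. K n \<subseteq> A"
    "(\<lambda>n. emeasure lebesgue (K n)) \<longlonglongrightarrow> emeasure lebesgue A"
proof -
  obtain a where a: "a \<in> A" using assms(2) by auto
  obtain C T where CT: "fsigma C" "T \<in> null_sets lebesgue" "C \<union> T = A"
    using lebesgue_set_almost_fsigma[OF assms(1)] by metis
  obtain F :: "nat \<Rightarrow> real set" where "range F \<subseteq> Collect compact" "C = (\<Union>n. F n)"
    using CT(1) unfolding fsigma_Union_compact by blast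
  then have F: "\<And>n. compact (F n)" "C = (\<Union>n. F n)" by auto
  \<comment> \<open>The point \<open>a\<close> keeps the compact sets nonempty even where the pieces
    \<open>F i\<close> are empty; the inequality for sums fails for empty sets.\<close>
  define K where "K n = insert a (\<Union>i\<le>n. F i)" for n
  have comp: "compact (K n)" for n unfolding K_def using F(1) by (intro compact_insert compact_UN) auto
  then have sets: "K n \<in> sets lebesgue" for n using lmeasurable_compact fmeasurableD by blast
  have sub: "K n \<subseteq> A" for n using a F(2) CT(3) by (auto simp: K_def)
  have "incseq K" by (force simp: incseq_def K_def)
  then have "(\<lambda>n. emeasure lebesgue (K n)) \<longlonglongrightarrow> emeasure lebesgue (\<Union>n. K n)"
    using sets by (intro Lim_emeasure_incseq) auto
  moreover have "emeasure lebesgue (\<Union>n. K n) = emeasure lebesgue A"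
  proof -
    have "(\<Union>n. K n) \<union> T = A" using a F(2) CT(3) by (auto simp: K_def)
    moreover have "(\<Union>n. K n) \<in> sets lebesgue" using sets by (intro sets.countable_UN) auto
    ultimately show ?thesis using emeasure_Un_null_set[OF _ CT(2), of "\<Union>n. K n"] by simp
  qed
  ultimately show ?thesis using that[of K] comp sub by (auto simp: K_def)
qed

text \<open>Inner regularity reduces this to compact sets. The superset \<open>S\<close> is there
  because a sum of Borel sets need not be Borel.\<close>

lemma emeasure_sums_real_ge:
  fixes A B S :: "real set"
  assumes "A \<in> sets borel" "A \<noteq> {}" "B \<in> sets borel" "B \<noteq> {}" "S \<in> sets borel"
    and sub: "\<And>x y. x \<in> A \<Longrightarrow> y \<in> B \<Longrightarrow> x + y \<in> S"
  shows "emeasure lborel A + emeasure lborel B \<le> emeasure lborel S"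
proof -
  obtain K where K: "\<And>n. compact (K n)" "\<And>n. K n \<noteq> {}" "\<And>n. K n \<subseteq> A"
    "(\<lambda>n. emeasure lebesgue (K n)) \<longlonglongrightarrow> emeasure lebesgue A"
    using compact_exhaustion_lebesgue[of A] assms by (metis sets_completionI_sets sets_lborel)
  obtain L where L: "\<And>n. compact (L n)" "\<And>n. L n \<noteq> {}" "\<And>n. L n \<subseteq> B"
    "(\<lambda>n. emeasure lebesgue (L n)) \<longlonglongrightarrow> emeasure lebesgue B"
    using compact_exhaustion_lebesgue[of B] assms by (metis sets_completionI_sets sets_lborel)
  have "(\<lambda>n. emeasure lborel (K n) + emeasure lborel (L n)) \<longlonglongrightarrow> emeasure lborel A + emeasure lborel B"
    using tendsto_add[OF K(4) L(4)] K(1) L(1) assms by (simp add: borel_compact)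
  moreover have "emeasure lborel (K n) + emeasure lborel (L n) \<le> emeasure lborel S" for n
    using K L sub assms by (intro emeasure_compact_sums_real_ge) (auto, blast)
  ultimately show ?thesis by (intro LIMSEQ_le_const2) auto
qed

lemma emeasure_convex_combination_real_ge:
  fixes A B S :: "real set"
  assumes "A \<in> sets borel" "A \<noteq> {}" "B \<in> sets borel" "B \<noteq> {}" "S \<in> sets borel" and lam: "0 < lam" "lam < 1"
    and sub: "\<And>x y. x \<in> A \<Longrightarrow> y \<in> B \<Longrightarrow> lam * x + (1 - lam) * y \<in> S"
  shows "ennreal lam * emeasure lborel A + ennreal (1 - lam) * emeasure lborel B \<le> emeasure lborel S"
proof -
  have sc: "(*) c ` C \<in> sets borel" "emeasure lborel ((*) c ` C) = ennreal c * emeasure lborel C"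
    if "C \<in> sets borel" "c > 0" for c and C :: "real set"
  proof -
    have eq: "(*) c ` C = (\<lambda>x. x / c) -` C"
    proof (intro equalityI subsetI)
      fix x assume "x \<in> (\<lambda>x. x / c) -` C"
      then show "x \<in> (*) c ` C" using that by (intro image_eqI[of _ _ "x / c"]) auto
    qed (use that in auto)
    show s: "(*) c ` C \<in> sets borel"
      unfolding eq using measurable_sets_borel[OF _ that(1), of "\<lambda>x. x / c"] by simp
    show "emeasure lborel ((*) c ` C) = ennreal c * emeasure lborel C"
      using emeasure_lebesgue_affine[of c 0 C] that s by (simp cong: image_cong_simp)
  qed
  have "emeasure lborel ((*) lam ` A) + emeasure lborel ((*) (1 - lam) ` B) \<le> emeasure lborel S"
    using assms by (intro emeasure_sums_real_ge sc) auto
  then show ?thesis using sc assms by simp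
qed

lemma nn_integral_layer_cake:
  fixes f :: "real \<Rightarrow> real"
  assumes [measurable]: "f \<in> borel_measurable borel"
  shows "(\<integral>\<^sup>+ x. ennreal (f x) \<partial>lborel) = (\<integral>\<^sup>+ s. emeasure lborel {x. s < f x} * indicator {0..} s \<partial>lborel)"
proof -
  have "ennreal (f x) = (\<integral>\<^sup>+ s. indicator {0..<f x} s \<partial>lborel)" for x
    by (cases "0 \<le> f x") (auto simp: ennreal_neg)
  then have "(\<integral>\<^sup>+ x. ennreal (f x) \<partial>lborel) = (\<integral>\<^sup>+ x. \<integral>\<^sup>+ s. indicator {s. s < f x} s * indicator {0..} s \<partial>lborel \<partial>lborel)"
    by (intro nn_integral_cong) (auto simp: indicator_def intro!: nn_integral_cong)
  also have "\<dots> = (\<integral>\<^sup>+ s. \<integral>\<^sup>+ x. indicator {s. s < f x} s * indicator {0..} s \<partial>lborel \<partial>lborel)"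
    by (rule lborel_pair.Fubini') measurable
  also have "\<dots> = (\<integral>\<^sup>+ s. (\<integral>\<^sup>+ x. indicator {x. s < f x} x \<partial>lborel) * indicator {0..} s \<partial>lborel)"
    by (subst nn_integral_multc[symmetric]) (auto simp: indicator_def intro!: nn_integral_cong)
  finally show ?thesis by simp
qed

text \<open>Dividing \<open>f\<close> and \<open>g\<close> by their suprema makes their superlevel
  sets nonempty at the same levels, namely below 1. The sum inequality at each level then gives a
  bound by the arithmetic mean of the normalized integrals, and Young's inequality passes to the
  geometric mean.\<close>

lemma prekopa_leindler_real:
  fixes f g h :: "real \<Rightarrow> real"
  assumes [measurable]: "f \<in> borel_measurable borel" "g \<in> borel_measurable borel" "h \<in> borel_measurable borel"
    and nonneg: "\<And>x. 0 \<le> f x" "\<And>x. 0 \<le> g x" "\<And>x. 0 \<le> h x"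
    and bdd: "bdd_above (range f)" "bdd_above (range g)"
    and lam: "0 < lam" "lam < 1"
    and le: "\<And>x y. f x powr lam * g y powr (1 - lam) \<le> h (lam * x + (1 - lam) * y)"
    and abc: "(\<integral>\<^sup>+ x. ennreal (f x) \<partial>lborel) = ennreal a" "(\<integral>\<^sup>+ x. ennreal (g x) \<partial>lborel) = ennreal b"
      "(\<integral>\<^sup>+ x. ennreal (h x) \<partial>lborel) = ennreal c" "0 \<le> a" "0 \<le> b" "0 \<le> c"
  shows "a powr lam * b powr (1 - lam) \<le> c"
proof (cases "a = 0 \<or> b = 0")
  case True then show ?thesis using \<open>0 \<le> c\<close> by auto
next
  case False
  then have ab: "a > 0" "b > 0" using \<open>0 \<le> a\<close> \<open>0 \<le> b\<close> by auto
  define A where "A = Sup (range f)"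
  define B where "B = Sup (range g)"
  have fA: "f x \<le> A" and gB: "g x \<le> B" for x
    using bdd by (auto simp: A_def B_def intro: cSup_upper)
  have "A > 0"
  proof (rule ccontr)
    assume "\<not> A > 0"
    then have "f x = 0" for x using fA[of x] nonneg(1)[of x] by simp
    then show False using abc(1) ab by simp
  qed
  have "B > 0"
  proof (rule ccontr)
    assume "\<not> B > 0"
    then have "g x = 0" for x using gB[of x] nonneg(2)[of x] by simp
    then show False using abc(2) ab by simp
  qed
  \<comment> \<open>The normalization of \<open>h\<close> that matches \<open>A\<close> and
    \<open>B\<close>, so that the hypothesis keeps its form after division.\<close>
  define C where "C = A powr lam * B powr (1 - lam)"
  have "C > 0" using \<open>A > 0\<close> \<open>B > 0\<close> by (simp add: C_def)
  have scale: "(\<integral>\<^sup>+ x. ennreal (k x / d) \<partial>lborel) = ennreal (e / d)"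
    if "(\<integral>\<^sup>+ x. ennreal (k x) \<partial>lborel) = ennreal e" "d > 0" "e \<ge> 0" "k \<in> borel_measurable borel" "\<And>x. 0 \<le> k x"
    for k :: "real \<Rightarrow> real" and d e
  proof -
    have "(\<integral>\<^sup>+ x. ennreal (k x / d) \<partial>lborel) = (\<integral>\<^sup>+ x. ennreal (1 / d) * ennreal (k x) \<partial>lborel)"
      using that by (intro nn_integral_cong) (simp flip: ennreal_mult)
    also have "\<dots> = ennreal (1 / d) * ennreal e" using that by (subst nn_integral_cmult) auto
    also have "\<dots> = ennreal (e / d)" using that by (simp flip: ennreal_mult)
    finally show ?thesis .
  qed
  have key: "ennreal lam * emeasure lborel {x. s < f x / A} + ennreal (1 - lam) * emeasure lborel {x. s < g x / B}
      \<le> emeasure lborel {x. s < h x / C}" if s: "0 < s" for s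
  proof (cases "s < 1")
    case True
    have "\<exists>x. s < f x / A"
    proof -
      have "s * A < Sup (range f)" using True \<open>A > 0\<close> by (simp add: A_def[symmetric])
      then show ?thesis using less_cSupD[of "range f" "s * A"] \<open>A > 0\<close> by (auto simp: field_simps)
    qed
    moreover have "\<exists>x. s < g x / B"
    proof -
      have "s * B < Sup (range g)" using True \<open>B > 0\<close> by (simp add: B_def[symmetric])
      then show ?thesis using less_cSupD[of "range g" "s * B"] \<open>B > 0\<close> by (auto simp: field_simps)
    qed
    moreover have "lam * x + (1 - lam) * y \<in> {x. s < h x / C}" if "s < f x / A" "s < g y / B" for x y
    proof -
      have "s = s powr lam * s powr (1 - lam)" using s by (simp flip: powr_add)
      also have "\<dots> < (f x / A) powr lam * (g y / B) powr (1 - lam)"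
        using s lam that by (intro mult_strict_mono powr_less_mono2) auto
      also have "\<dots> = f x powr lam * g y powr (1 - lam) / C"
        using nonneg(1)[of x] nonneg(2)[of y] \<open>A > 0\<close> \<open>B > 0\<close> by (simp add: powr_divide C_def)
      also have "\<dots> \<le> h (lam * x + (1 - lam) * y) / C"
        using le \<open>C > 0\<close> by (intro divide_right_mono) auto
      finally show ?thesis by simp
    qed
    ultimately show ?thesis
      using lam by (intro emeasure_convex_combination_real_ge) auto
  next
    case False
    have "f x / A \<le> s" "g x / B \<le> s" for x
      using fA[of x] gB[of x] \<open>A > 0\<close> \<open>B > 0\<close> False by (smt (verit) divide_le_eq_1_pos)+
    then have "{x. s < f x / A} = {}" "{x. s < g x / B} = {}" by (auto simp: not_less)
    then show ?thesis by simp
  qed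
  have [measurable]: "(\<lambda>s. emeasure lborel {x. s < k x}) \<in> borel_measurable lborel" 
    if [measurable]: "k \<in> borel_measurable borel" for k :: "real \<Rightarrow> real"
  proof -
    have "{x \<in> space lborel. s < k x} = {x. s < k x}" for s by simp
    moreover have "(\<lambda>s. emeasure lborel {x \<in> space lborel. s < k x}) \<in> borel_measurable lborel" by measurable
    ultimately show ?thesis by simp
  qed
  have "ennreal (lam * (a / A) + (1 - lam) * (b / B)) =
     ennreal lam * (\<integral>\<^sup>+ x. ennreal (f x / A) \<partial>lborel) + ennreal (1 - lam) * (\<integral>\<^sup>+ x. ennreal (g x / B) \<partial>lborel)"
    using scale[OF abc(1) \<open>A > 0\<close>] scale[OF abc(2) \<open>B > 0\<close>] ab nonneg lam \<open>A > 0\<close> \<open>B > 0\<close>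
    by (simp flip: ennreal_plus ennreal_mult)
  also have "\<dots> = (\<integral>\<^sup>+ s. ennreal lam * (emeasure lborel {x. s < f x / A} * indicator {0..} s) +
      ennreal (1 - lam) * (emeasure lborel {x. s < g x / B} * indicator {0..} s) \<partial>lborel)"
    by (subst (1 2) nn_integral_layer_cake, simp, simp, subst nn_integral_add)
       (simp_all add: nn_integral_cmult)
  also have "\<dots> \<le> (\<integral>\<^sup>+ s. emeasure lborel {x. s < h x / C} * indicator {0..} s \<partial>lborel)"
  proof (rule nn_integral_mono_AE)
    \<comment> \<open>\<open>key\<close> speaks of positive levels only, and level 0 is a null
      set.\<close>
    have "AE s in lborel. s \<noteq> (0::real)" by (rule AE_lborel_singleton)
    then show "AE s in lborel. ennreal lam * (emeasure lborel {x. s < f x / A} * indicator {0..} s) +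
      ennreal (1 - lam) * (emeasure lborel {x. s < g x / B} * indicator {0..} s) \<le> emeasure lborel {x. s < h x / C} * indicator {0..} s"
      by eventually_elim (use key in \<open>auto simp: indicator_def\<close>)
  qed
  also have "\<dots> = (\<integral>\<^sup>+ x. ennreal (h x / C) \<partial>lborel)" by (rule nn_integral_layer_cake[symmetric]) simp
  also have "\<dots> = ennreal (c / C)" by (rule scale[OF abc(3) \<open>C > 0\<close> \<open>0 \<le> c\<close>]) (simp_all add: nonneg)
  finally have "lam * (a / A) + (1 - lam) * (b / B) \<le> c / C"
    using \<open>0 \<le> c\<close> \<open>C > 0\<close> by (simp add: ennreal_le_iff)
  moreover have "(a / A) powr lam * (b / B) powr (1 - lam) \<le> lam * (a / A) + (1 - lam) * (b / B)"
    using lam ab \<open>A > 0\<close> \<open>B > 0\<close> by (intro Youngs_inequality_0) auto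
  moreover have "(a / A) powr lam * (b / B) powr (1 - lam) = a powr lam * b powr (1 - lam) / C"
    using ab \<open>A > 0\<close> \<open>B > 0\<close> by (simp add: powr_divide C_def)
  ultimately have "a powr lam * b powr (1 - lam) / C \<le> c / C" by linarith
  then show ?thesis using \<open>C > 0\<close> by (simp add: divide_le_cancel)
qed

subsection \<open>Even log-concave densities\<close>

lemma mem_compact_convexI:
  fixes Z :: "'a::euclidean_space set"
  assumes "compact Z" "convex Z" "Z \<noteq> {}"
    and le: "\<And>u. norm u = 1 \<Longrightarrow> u \<bullet> x \<le> support_function Z u"
  shows "x \<in> Z"
proof (rule ccontr)
  assume "x \<notin> Z"
  then obtain a b where ab: "a \<bullet> x < b" "\<And>z. z \<in> Z \<Longrightarrow> b < a \<bullet> z"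
    using separating_hyperplane_closed_point[OF assms(2) compact_imp_closed[OF assms(1)]] by metis
  have "a \<noteq> 0" using ab assms(3) by fastforce
  \<comment> \<open>The separation gives a lower bound on \<open>Z\<close>, so the sign is flipped
    to contradict a bound by the support function.\<close>
  define u where "u = - a /\<^sub>R norm a"
  have u: "norm u = 1" using \<open>a \<noteq> 0\<close> by (simp add: u_def)
  obtain z where z: "z \<in> Z" "u \<bullet> z = support_function Z u"
    using support_function_attained assms by metis
  have "a \<bullet> x < a \<bullet> z" using ab z by force
  then have "u \<bullet> z < u \<bullet> x" using \<open>a \<noteq> 0\<close> by (simp add: u_def field_simps)
  then show False using le[OF u] z by simp
qed

text \<open>\<open>A\<close>, \<open>B\<close> and \<open>C\<close> will be superlevel sets, which
  need not be closed. Taking closures costs nothing, since the frontier of a convex set is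
  negligible. The link to \<open>C\<close> is the weighted arithmetic-geometric mean inequality,
  which places a logarithmic sum inside the Minkowski combination.\<close>

lemma measure_log_sum_Int_ge:
  fixes K L :: "(real^2) set"
  assumes K: "symmetric_convex_body K" and L: "symmetric_convex_body L" and lam: "0 < lam" "lam < 1"
    and A: "convex A" "\<And>x. x \<in> A \<Longrightarrow> - x \<in> A" and B: "convex B" "\<And>x. x \<in> B \<Longrightarrow> - x \<in> B" and C: "convex C"
    and sub: "\<And>a b. a \<in> A \<Longrightarrow> b \<in> B \<Longrightarrow> lam *\<^sub>R a + (1 - lam) *\<^sub>R b \<in> C"
  shows "measure lebesgue (K \<inter> A) powr lam * measure lebesgue (L \<inter> B) powr (1 - lam)
     \<le> measure lebesgue (log_sum lam K L \<inter> C)"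
proof (cases "measure lebesgue (K \<inter> A) = 0 \<or> measure lebesgue (L \<inter> B) = 0")
  case True
  then show ?thesis by auto
next
  case False
  \<comment> \<open>A nonzero area yields a nonempty interior; this is why the case of zero area is
    split off first.\<close>
  have cl: "symmetric_convex_body (closure (M \<inter> D))" "measure lebesgue (closure (M \<inter> D)) = measure lebesgue (M \<inter> D)"
      "closure (M \<inter> D) \<subseteq> M"
    if M: "symmetric_convex_body M" and D: "convex D" "\<And>x. x \<in> D \<Longrightarrow> - x \<in> D" and ne: "measure lebesgue (M \<inter> D) \<noteq> 0" for M D :: "(real^2) set"
  proof -
    note MD = symmetric_convex_bodyD[OF M]
    have bd: "bounded (M \<inter> D)" using compact_imp_bounded[OF MD(1)] by (rule bounded_subset) auto
    have cv: "convex (M \<inter> D)" using MD D by (intro convex_Int) auto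
    show "measure lebesgue (closure (M \<inter> D)) = measure lebesgue (M \<inter> D)"
      by (rule measure_closure[OF bd negligible_convex_frontier[OF cv]])
    show "closure (M \<inter> D) \<subseteq> M" using compact_imp_closed[OF MD(1)] by (intro closure_minimal) auto
    show "symmetric_convex_body (closure (M \<inter> D))"
    proof (rule symmetric_convex_bodyI)
      show "compact (closure (M \<inter> D))" using bd by simp
      show "convex (closure (M \<inter> D))" using cv by (rule convex_closure)
      have "interior (M \<inter> D) \<noteq> {}"
        using negligible_convex_interior[OF cv] ne negligible_imp_measure0 by blast
      then show "interior (closure (M \<inter> D)) \<noteq> {}" using interior_mono[OF closure_subset[of "M \<inter> D"]] by blast
      have eq: "uminus ` (M \<inter> D) = M \<inter> D"
      proof (intro equalityI subsetI)
        fix x assume "x \<in> M \<inter> D" then show "x \<in> uminus ` (M \<inter> D)"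
          using MD(5)[of x] D(2)[of x] by (intro image_eqI[of _ _ "- x"]) auto
      qed (use MD(5) D(2) in auto)
      show "- x \<in> closure (M \<inter> D)" if "x \<in> closure (M \<inter> D)" for x
        using that continuous_image_closure_subset[of UNIV uminus "M \<inter> D"] continuous_on_minus[OF continuous_on_id]
        unfolding eq by blast
    qed
  qed
  define K' where "K' = closure (K \<inter> A)"
  define L' where "L' = closure (L \<inter> B)"
  have K': "symmetric_convex_body K'" "measure lebesgue K' = measure lebesgue (K \<inter> A)" "K' \<subseteq> K"
    using cl[OF K A] False by (simp_all add: K'_def)
  have L': "symmetric_convex_body L'" "measure lebesgue L' = measure lebesgue (L \<inter> B)" "L' \<subseteq> L"
    using cl[OF L B] False by (simp_all add: L'_def)
  note KD = symmetric_convex_bodyD[OF K'(1)] and LD = symmetric_convex_bodyD[OF L'(1)]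
  have "log_sum lam K' L' \<subseteq> log_sum lam K L"
  proof
    fix x assume x: "x \<in> log_sum lam K' L'"
    show "x \<in> log_sum lam K L" unfolding log_sum_def
    proof (intro CollectI ballI)
      fix u :: "real^2" assume "u \<in> sphere 0 1"
      then have u: "norm u = 1" by simp
      have "x \<bullet> u \<le> support_function K' u powr lam * support_function L' u powr (1 - lam)"
        using x \<open>u \<in> _\<close> by (simp add: log_sum_def)
      also have "\<dots> \<le> support_function K u powr lam * support_function L u powr (1 - lam)"
        using support_function_mono[OF symmetric_convex_bodyD(1)[OF K] K'(3) KD(4), of u]
          support_function_mono[OF symmetric_convex_bodyD(1)[OF L] L'(3) LD(4), of u]
          support_function_pos_unit[OF K'(1) u] support_function_pos_unit[OF L'(1) u] lam
        by (intro mult_mono powr_mono2) auto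
      finally show "x \<bullet> u \<le> support_function K u powr lam * support_function L u powr (1 - lam)" .
    qed
  qed
  moreover have "log_sum lam K' L' \<subseteq> closure C"
  proof
    fix x assume x: "x \<in> log_sum lam K' L'"
    let ?f = "\<lambda>(a, b). lam *\<^sub>R a + (1 - lam) *\<^sub>R b :: real^2"
    let ?Z = "?f ` (K' \<times> L')"
    have cont: "continuous_on S ?f" for S unfolding case_prod_unfold by (intro continuous_intros)
    have lin: "linear ?f" unfolding case_prod_unfold
      by (rule linearI) (simp_all add: algebra_simps)
    have Z: "compact ?Z" "convex ?Z" "?Z \<noteq> {}"
      using KD LD by (auto intro!: compact_continuous_image[OF cont] compact_Times convex_linear_image[OF lin] convex_Times)
    have "x \<in> ?Z"
    proof (rule mem_compact_convexI[OF Z])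
      fix u :: "real^2" assume u: "norm u = 1"
      obtain a where a: "a \<in> K'" "u \<bullet> a = support_function K' u" using support_function_attained[OF KD(1,4)] by metis
      obtain b where b: "b \<in> L'" "u \<bullet> b = support_function L' u" using support_function_attained[OF LD(1,4)] by metis
      have "u \<bullet> x \<le> support_function K' u powr lam * support_function L' u powr (1 - lam)"
        using x u by (simp add: log_sum_def inner_commute)
      also have "\<dots> \<le> lam * support_function K' u + (1 - lam) * support_function L' u"
        using lam support_function_pos_unit[OF K'(1) u] support_function_pos_unit[OF L'(1) u]
        by (intro Youngs_inequality_0) auto
      also have "\<dots> = u \<bullet> ?f (a, b)" by (simp add: inner_simps a b)
      also have "\<dots> \<le> support_function ?Z u"
        using a b by (intro inner_le_support_function Z) auto
      finally show "u \<bullet> x \<le> support_function ?Z u" .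
    qed
    also have "?Z \<subseteq> closure (?f ` ((K \<inter> A) \<times> (L \<inter> B)))"
      unfolding K'_def L'_def closure_Times[symmetric] by (rule continuous_image_closure_subset[OF cont]) auto
    also have "\<dots> \<subseteq> closure C" using sub by (intro closure_mono) auto
    finally show "x \<in> closure C" .
  qed
  \<comment> \<open>Only the closure of \<open>C\<close> is reached, and the excess lies in its
    negligible frontier.\<close>
  moreover have "closure C = C \<union> frontier C" by (rule closure_Un_frontier)
  ultimately have sb: "log_sum lam K' L' \<subseteq> (log_sum lam K L \<inter> C) \<union> (log_sum lam K L \<inter> frontier C)" by blast
  have lm: "log_sum lam K L \<in> lmeasurable" and lm': "log_sum lam K' L' \<in> lmeasurable"
    using log_sum_symmetric_convex_body[OF K L, of lam] log_sum_symmetric_convex_body[OF K'(1) L'(1), of lam] lam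
    by (auto intro: lmeasurable_compact symmetric_convex_bodyD(1))
  have lmC: "log_sum lam K L \<inter> C \<in> lmeasurable"
    using log_sum_symmetric_convex_body[OF K L, of lam] lam C
    by (intro measurable_convex convex_Int bounded_Int) (auto dest: symmetric_convex_bodyD(1,2) intro: compact_imp_bounded)
  have neg: "negligible (log_sum lam K L \<inter> frontier C)"
    by (rule negligible_subset[OF negligible_convex_frontier[OF C]]) auto
  have "measure lebesgue (K \<inter> A) powr lam * measure lebesgue (L \<inter> B) powr (1 - lam)
     \<le> measure lebesgue (log_sum lam K' L')"
    using log_brunn_minkowski_plane[OF K'(1) L'(1), of lam] lam K' L' by simp
  also have "\<dots> \<le> measure lebesgue ((log_sum lam K L \<inter> C) \<union> (log_sum lam K L \<inter> frontier C))"
    using sb lm' lmC neg by (intro measure_mono_fmeasurable) (auto intro: fmeasurable.Un negligible_imp_measurable)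
  also have "\<dots> = measure lebesgue (log_sum lam K L \<inter> C)"
    using lmC neg by (intro measure_Un_null_set) (auto simp: negligible_iff_null_sets)
  finally show ?thesis .
qed

section \<open>Log-concave functions and their superlevel sets\<close>

lemma log_concave_ge:
  assumes f: "log_concave f" and pos: "0 < f x" "0 < f y" and t: "0 \<le> t" "t \<le> 1"
  shows "f x powr (1 - t) * f y powr t \<le> f ((1 - t) *\<^sub>R x + t *\<^sub>R y)"
proof -
  let ?z = "(1 - t) *\<^sub>R x + t *\<^sub>R y"
  have "ereal (1 - t) * eln (f x) + ereal t * eln (f y) \<le> eln (f ?z)"
    using f t by (auto simp: log_concave_def)
  then have *: "ereal ((1 - t) * ln (f x) + t * ln (f y)) \<le> eln (f ?z)" using pos by (simp add: eln_def)
  then have z: "0 < f ?z" by (auto simp: eln_def split: if_splits)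
  with * have "(1 - t) * ln (f x) + t * ln (f y) \<le> ln (f ?z)" by (simp add: eln_def)
  then have "exp ((1 - t) * ln (f x) + t * ln (f y)) \<le> exp (ln (f ?z))" by simp
  then show ?thesis using pos z by (simp add: powr_def exp_add)
qed

lemma log_concave_superlevel:
  assumes f: "log_concave f" and x: "s \<le> f x" "0 < s" and y: "r \<le> f y" "0 < r" and t: "0 \<le> t" "t \<le> 1"
  shows "s powr (1 - t) * r powr t \<le> f ((1 - t) *\<^sub>R x + t *\<^sub>R y)"
proof -
  have "s powr (1 - t) * r powr t \<le> f x powr (1 - t) * f y powr t"
    using assms by (intro mult_mono powr_mono2) auto
  also have "\<dots> \<le> f ((1 - t) *\<^sub>R x + t *\<^sub>R y)"
    using assms by (intro log_concave_ge) auto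
  finally show ?thesis .
qed

lemma convex_superlevel_log_concave:
  assumes f: "log_concave f" and "0 < s" shows "convex {x. s \<le> f x}"
  unfolding convex_alt
proof (intro ballI allI impI)
  fix x y t assume "x \<in> {x. s \<le> f x}" "y \<in> {x. s \<le> f x}" "0 \<le> t \<and> t \<le> (1::real)"
  then have "s powr (1 - t) * s powr t \<le> f ((1 - t) *\<^sub>R x + t *\<^sub>R y)"
    using assms by (intro log_concave_superlevel[OF f]) auto
  then show "(1 - t) *\<^sub>R x + t *\<^sub>R y \<in> {x. s \<le> f x}" using \<open>0 < s\<close> by (simp flip: powr_add)
qed

text \<open>A convex set need not be Borel, but it is its interior together with part of a
  negligible frontier, and completeness takes care of that part.\<close>

lemma convex_imp_sets_lebesgue:
  fixes S :: "'a::euclidean_space set"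
  assumes "convex S" shows "S \<in> sets lebesgue"
proof -
  have "S \<inter> frontier S \<in> sets lebesgue"
    by (rule negligible_imp_sets, rule negligible_subset[OF negligible_convex_frontier[OF assms]]) auto
  moreover have "interior S \<in> sets lebesgue" by (simp add: sets_completionI_sets)
  moreover have "S = interior S \<union> (S \<inter> frontier S)"
    using interior_subset[of S] closure_subset[of S] by (auto simp: frontier_def)
  ultimately show ?thesis using sets.Un[of "interior S" lebesgue "S \<inter> frontier S"] by simp
qed

lemma log_concave_measurable:
  fixes f :: "'a::euclidean_space \<Rightarrow> real"
  assumes f: "log_concave f" shows "f \<in> borel_measurable lebesgue"
  unfolding borel_measurable_iff_ge
proof
  fix a
  show "{w \<in> space lebesgue. a \<le> f w} \<in> sets lebesgue"
  proof (cases "0 < a")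
    case True
    then show ?thesis using convex_imp_sets_lebesgue[OF convex_superlevel_log_concave[OF f]] by simp
  next
    case False
    then have "{w \<in> space lebesgue. a \<le> f w} = UNIV"
      using f unfolding log_concave_def by (auto intro: order_trans[of _ 0])
    then show ?thesis by simp
  qed
qed

text \<open>The origin is the midpoint of \<open>x\<close> and \<open>- x\<close>. The resulting
  bound makes \<open>\<mu>\<close> finite on sets of finite area and provides the boundedness that
  \<open>prekopa_leindler_real\<close> asks for.\<close>

lemma even_log_concave_le_0:
  assumes f: "log_concave f" and even: "\<And>x. f (- x) = f x" shows "f x \<le> f 0"
proof (cases "0 < f x")
  case True
  then have "f x powr (1 - 1/2) * f (- x) powr (1/2) \<le> f ((1 - 1/2) *\<^sub>R x + (1/2) *\<^sub>R (- x))"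
    using even by (intro log_concave_ge[OF f]) auto
  then show ?thesis using True by (simp add: even flip: powr_add)
next
  case False
  then show ?thesis using f by (auto simp: log_concave_def intro: order_trans[of _ 0])
qed

section \<open>The measure as an integral over levels\<close>

lemma sigma_finite_lebesgue: "sigma_finite_measure (lebesgue :: 'a::euclidean_space measure)"
proof
  obtain A :: "'a set set" where A: "countable A" "A \<subseteq> sets lborel" "\<Union>A = space lborel" "\<forall>a\<in>A. emeasure lborel a \<noteq> \<infinity>"
    using lborel.sigma_finite_countable by metis
  show "\<exists>A::'a set set. countable A \<and> A \<subseteq> sets lebesgue \<and> \<Union> A = space lebesgue \<and> (\<forall>a\<in>A. emeasure lebesgue a \<noteq> \<infinity>)"
    using A by (intro exI[of _ A]) (auto intro: sets_completionI_sets)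
qed

text \<open>Layer cake with the level written as \<open>exp (- x)\<close>. In this scale a weighted
  geometric mean of levels is a weighted arithmetic mean of the parameters, which is the form that
  the Prekopa-Leindler inequality needs.\<close>

lemma ennreal_eq_nn_integral_exp:
  fixes r :: real
  assumes "0 \<le> r"
  shows "ennreal r = (\<integral>\<^sup>+ x. ennreal (exp (- x)) * indicator {x. exp (- x) \<le> r} x \<partial>lborel)"
proof (cases "r = 0")
  case True
  then have "{x. exp (- x) \<le> r} = {}" by (auto simp: not_le)
  then show ?thesis using True by simp
next
  case False
  then have r: "r > 0" using assms by simp
  have "exp (- x) \<le> r \<longleftrightarrow> - ln r \<le> x" for x
    using r by (metis exp_le_cancel_iff exp_ln minus_le_iff)
  then have "{x. exp (- x) \<le> r} = {- ln r..}" by auto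
  moreover have "(\<integral>\<^sup>+ x. ennreal (exp (- x)) * indicator {- ln r..} x \<partial>lborel) = ennreal (0 - (- exp (- (- ln r))))"
  proof (rule nn_integral_FTC_atLeast)
    show "((\<lambda>x::real. - exp (- x)) \<longlongrightarrow> 0) at_top"
      using tendsto_minus[OF filterlim_compose[OF exp_at_bot filterlim_uminus_at_bot_at_top]] by simp
  qed (auto intro!: derivative_eq_intros)
  ultimately show ?thesis using r by simp
qed

lemma emeasure_density_layer_cake:
  fixes f :: "'a::euclidean_space \<Rightarrow> real"
  assumes f: "f \<in> borel_measurable lebesgue" "\<And>x. 0 \<le> f x" and S: "S \<in> lmeasurable"
  shows "emeasure (density lebesgue (\<lambda>x. ennreal (f x))) S
      = (\<integral>\<^sup>+ x. ennreal (exp (- x) * measure lebesgue (S \<inter> {z. exp (- x) \<le> f z})) \<partial>lborel)"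
proof -
  interpret L: sigma_finite_measure "lebesgue :: 'a measure" by (rule sigma_finite_lebesgue)
  \<comment> \<open>The density is only Lebesgue measurable, so Fubini pairs \<open>lborel\<close>
    for the levels with the completed measure on the space.\<close>
  interpret P: pair_sigma_finite "lborel :: real measure" "lebesgue :: 'a measure" ..
  note [measurable] = f(1) fmeasurableD[OF S]
  have lev: "S \<inter> {z. exp (- x) \<le> f z} \<in> lmeasurable" for x
  proof -
    have "{z \<in> space lebesgue. exp (- x) \<le> f z} \<in> sets lebesgue" by measurable
    then show ?thesis using S by (intro fmeasurable_Int_fmeasurable) auto
  qed
  have "emeasure (density lebesgue (\<lambda>x. ennreal (f x))) S = (\<integral>\<^sup>+ z. ennreal (f z) * indicator S z \<partial>lebesgue)"
    by (rule emeasure_density) auto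
  also have "\<dots> = (\<integral>\<^sup>+ z. (\<integral>\<^sup>+ x. ennreal (exp (- x)) * indicator {x. exp (- x) \<le> f z} x * indicator S z \<partial>lborel) \<partial>lebesgue)"
    by (subst nn_integral_multc) (auto simp: ennreal_eq_nn_integral_exp[OF f(2)])
  also have "\<dots> = (\<integral>\<^sup>+ x. (\<integral>\<^sup>+ z. ennreal (exp (- x)) * indicator {x. exp (- x) \<le> f z} x * indicator S z \<partial>lebesgue) \<partial>lborel)"
    by (rule P.Fubini') measurable
  also have "\<dots> = (\<integral>\<^sup>+ x. (\<integral>\<^sup>+ z. ennreal (exp (- x)) * indicator (S \<inter> {z. exp (- x) \<le> f z}) z \<partial>lebesgue) \<partial>lborel)"
    by (intro nn_integral_cong) (auto simp: indicator_def)
  also have "\<dots> = (\<integral>\<^sup>+ x. ennreal (exp (- x) * measure lebesgue (S \<inter> {z. exp (- x) \<le> f z})) \<partial>lborel)"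
    using lev by (intro nn_integral_cong) (simp add: nn_integral_cmult_indicator fmeasurableD emeasure_eq_measure2 ennreal_mult)
  finally show ?thesis .
qed

lemma even_log_concave_log_sum:
  fixes f :: "real ^ 2 \<Rightarrow> real"
  assumes f: "log_concave f" and even: "\<And>x. f (- x) = f x"
    and K: "symmetric_convex_body K" and L: "symmetric_convex_body L" and lam: "0 < lam" "lam < 1"
  defines "\<mu> \<equiv> density lebesgue (\<lambda>x. ennreal (f x))"
  shows "measure \<mu> K powr lam * measure \<mu> L powr (1 - lam) \<le> measure \<mu> (log_sum lam K L)"
    and "\<And>S. S \<in> lmeasurable \<Longrightarrow> S \<in> fmeasurable \<mu>"
proof -
  have nonneg: "0 \<le> f x" for x using f by (simp add: log_concave_def)
  have meas: "f \<in> borel_measurable lebesgue" by (rule log_concave_measurable[OF f])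
  have le0: "f x \<le> f 0" for x by (rule even_log_concave_le_0[OF f even])
  define M where "M x = {z. exp (- x) \<le> f z}" for x :: real
  have M_convex: "convex (M x)" for x unfolding M_def by (rule convex_superlevel_log_concave[OF f]) simp
  have M_sets: "M x \<in> sets lebesgue" for x by (rule convex_imp_sets_lebesgue[OF M_convex])
  have M_sym: "- z \<in> M x" if "z \<in> M x" for x z using that by (simp add: M_def even)
  have IntM: "S \<inter> M x \<in> lmeasurable" if "S \<in> lmeasurable" for S x
    using that M_sets[of x] by (intro fmeasurable_Int_fmeasurable) 
  show fm: "S \<in> fmeasurable \<mu>" if S: "S \<in> lmeasurable" for S
  proof (rule fmeasurableI)
    show "S \<in> sets \<mu>" using S by (simp add: \<mu>_def fmeasurableD)
    have "emeasure \<mu> S = (\<integral>\<^sup>+ z. ennreal (f z) * indicator S z \<partial>lebesgue)"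
      unfolding \<mu>_def using meas S by (intro emeasure_density) (auto simp: fmeasurableD)
    also have "\<dots> \<le> (\<integral>\<^sup>+ z. ennreal (f 0) * indicator S z \<partial>lebesgue)"
      using le0 by (intro nn_integral_mono mult_right_mono ennreal_leI) auto
    also have "\<dots> = ennreal (f 0) * emeasure lebesgue S"
      using S by (simp add: nn_integral_cmult_indicator fmeasurableD)
    also have "\<dots> < \<infinity>" using S by (simp add: ennreal_mult_less_top fmeasurable_def del: emeasure_completion)
    finally show "emeasure \<mu> S < \<infinity>" .
  qed
  define \<Phi> where "\<Phi> S x = exp (- x) * measure lebesgue (S \<inter> M x)" for S x
  have \<Phi>_int: "(\<integral>\<^sup>+ x. ennreal (\<Phi> S x) \<partial>lborel) = ennreal (measure \<mu> S)" if S: "S \<in> lmeasurable" for S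
    using emeasure_density_layer_cake[OF meas nonneg S] emeasure_eq_measure2[OF fm[OF S]]
    by (simp add: \<Phi>_def M_def \<mu>_def)
  have \<Phi>_meas: "\<Phi> S \<in> borel_measurable borel" if S: "S \<in> lmeasurable" for S
  proof -
    \<comment> \<open>The superlevel sets grow with \<open>x\<close>, and monotone functions are
      Borel measurable.\<close>
    have "mono (\<lambda>x. measure lebesgue (S \<inter> M x))"
    proof (rule monoI, rule measure_mono_fmeasurable)
      fix x y :: real assume "x \<le> y"
      then have "exp (- y) \<le> exp (- x)" by simp
      from order_trans[OF this] show "S \<inter> M x \<subseteq> S \<inter> M y" by (auto simp: M_def)
    qed (use IntM[OF S] in \<open>auto simp: fmeasurableD\<close>)
    then have [measurable]: "(\<lambda>x. measure lebesgue (S \<inter> M x)) \<in> borel_measurable borel"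
      by (rule borel_measurable_mono)
    show ?thesis unfolding \<Phi>_def[abs_def] by measurable
  qed
  have \<Phi>_bdd: "bdd_above (range (\<Phi> S))" if S: "S \<in> lmeasurable" for S
  proof (rule bdd_aboveI2)
    fix x
    show "\<Phi> S x \<le> f 0 * measure lebesgue S"
    proof (cases "M x = {}")
      case True
      then show ?thesis using nonneg by (simp add: \<Phi>_def)
    next
      case False
      \<comment> \<open>A nonempty superlevel set forces its level below the maximum
        \<open>f 0\<close>, which keeps the growing factor \<open>exp (- x)\<close> under
        control.\<close>
      then have "exp (- x) \<le> f 0" using le0 by (auto simp: M_def intro: order_trans)
      moreover have "measure lebesgue (S \<inter> M x) \<le> measure lebesgue S"
        using IntM[OF S] S by (intro measure_mono_fmeasurable) (auto simp: fmeasurableD)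
      ultimately show ?thesis unfolding \<Phi>_def using nonneg by (intro mult_mono) auto
    qed
  qed
  have lm: "K \<in> lmeasurable" "L \<in> lmeasurable" "log_sum lam K L \<in> lmeasurable"
    using K L log_sum_symmetric_convex_body[OF K L, of lam] lam
    by (auto intro!: lmeasurable_compact dest: symmetric_convex_bodyD(1))
  show "measure \<mu> K powr lam * measure \<mu> L powr (1 - lam) \<le> measure \<mu> (log_sum lam K L)"
  proof (rule prekopa_leindler_real[of "\<Phi> K" "\<Phi> L" "\<Phi> (log_sum lam K L)"])
    fix x y :: real
    let ?z = "lam * x + (1 - lam) * y"
    \<comment> \<open>\<open>log_concave\<close> puts the weight \<open>1 - t\<close> on its first
      argument, hence the instance \<open>1 - lam\<close> for \<open>t\<close>.\<close>
    have "lam *\<^sub>R a + (1 - lam) *\<^sub>R b \<in> M ?z" if "a \<in> M x" "b \<in> M y" for a b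
      using log_concave_superlevel[OF f, of "exp (- x)" a "exp (- y)" b "1 - lam"] that lam
      by (simp add: M_def powr_def flip: exp_add)
    then have "measure lebesgue (K \<inter> M x) powr lam * measure lebesgue (L \<inter> M y) powr (1 - lam)
        \<le> measure lebesgue (log_sum lam K L \<inter> M ?z)"
      by (intro measure_log_sum_Int_ge K L lam M_convex M_sym) auto
    then have "exp (- ?z) * (measure lebesgue (K \<inter> M x) powr lam * measure lebesgue (L \<inter> M y) powr (1 - lam))
       \<le> \<Phi> (log_sum lam K L) ?z"
      by (simp add: \<Phi>_def)
    moreover have "\<Phi> K x powr lam * \<Phi> L y powr (1 - lam) =
       (exp (- x) powr lam * exp (- y) powr (1 - lam)) * (measure lebesgue (K \<inter> M x) powr lam * measure lebesgue (L \<inter> M y) powr (1 - lam))"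
      by (simp add: \<Phi>_def powr_mult)
    moreover have "exp (- x) powr lam * exp (- y) powr (1 - lam) = exp (- ?z)"
      by (simp add: powr_def flip: exp_add)
    ultimately show "\<Phi> K x powr lam * \<Phi> L y powr (1 - lam) \<le> \<Phi> (log_sum lam K L) ?z" by simp
  qed (use lm lam \<Phi>_int \<Phi>_meas \<Phi>_bdd in \<open>auto simp: \<Phi>_def\<close>)
qed

text \<open>The bound defining this logarithmic sum is the support function of the dilate, and a
  compact convex set is cut out by its support function. The inclusion is all that monotonicity of
  the measure uses.\<close>

lemma log_sum_scaleR_subset:
  assumes K: "symmetric_convex_body K" and ab: "0 < a" "0 < b"
  shows "log_sum lam ((*\<^sub>R) a ` K) ((*\<^sub>R) b ` K) \<subseteq> (*\<^sub>R) (a powr lam * b powr (1 - lam)) ` K"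
proof
  note KD = symmetric_convex_bodyD[OF K]
  let ?c = "a powr lam * b powr (1 - lam)"
  have c: "0 < ?c" using ab by simp
  note D = symmetric_convex_bodyD[OF symmetric_convex_body_scaleR[OF K c]]
  fix x assume x: "x \<in> log_sum lam ((*\<^sub>R) a ` K) ((*\<^sub>R) b ` K)"
  show "x \<in> (*\<^sub>R) ?c ` K"
  proof (rule mem_compact_convexI[OF D(1,2,4)])
    fix u :: 'a assume u: "norm u = 1"
    have s: "0 < support_function K u" using K u by (rule support_function_pos_unit)
    have "u \<bullet> x \<le> (a * support_function K u) powr lam * (b * support_function K u) powr (1 - lam)"
      using x u ab by (simp add: log_sum_def inner_commute support_function_scaleR KD(1,4))
    also have "\<dots> = ?c * (support_function K u powr lam * support_function K u powr (1 - lam))"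
      using ab s by (simp add: powr_mult)
    also have "support_function K u powr lam * support_function K u powr (1 - lam) = support_function K u"
      using s by (simp flip: powr_add)
    finally show "u \<bullet> x \<le> support_function ((*\<^sub>R) ?c ` K) u"
      using c by (simp add: support_function_scaleR KD(1,4))
  qed
qed

text \<open>With both weights positive, a zero value makes the left side
  \<open>-\<infinity>\<close>. At the endpoints this breaks down, because
  \<open>0 * (-\<infinity>) = 0\<close> in \<open>ereal\<close>, so they are treated
  separately.\<close>

lemma eln_weighted_le:
  assumes "0 \<le> a" "0 \<le> b" "0 < t" "t < 1" and le: "a powr (1 - t) * b powr t \<le> c"
  shows "ereal (1 - t) * eln a + ereal t * eln b \<le> eln c"
proof (cases "a = 0 \<or> b = 0")
  case True
  then show ?thesis using assms by (auto simp: eln_def)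
next
  case False
  then have ab: "0 < a" "0 < b" using assms by auto
  then have "0 < a powr (1 - t) * b powr t" by simp
  then have c: "0 < c" using le by linarith
  then have "ln (a powr (1 - t) * b powr t) \<le> ln c" using le ab by (subst ln_le_cancel_iff) auto
  then have "(1 - t) * ln a + t * ln b \<le> ln c" using ab by (simp add: ln_mult ln_powr)
  then show ?thesis using ab c by (simp add: eln_def)
qed

theorem corollary3p3:
  fixes f :: "real ^ 2 \<Rightarrow> real" and \<mu> :: "(real ^ 2) measure"
  assumes "log_concave f"
    and "\<And>x. f (- x) = f x"
    and "\<mu> = density lebesgue (\<lambda>x. ennreal (f x))"
  shows "(\<forall>K L :: (real ^ 2) set. \<forall>lam :: real.
            symmetric_convex_body K \<longrightarrow> symmetric_convex_body L \<longrightarrow> 0 < lam \<longrightarrow> lam < 1 \<longrightarrow>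
            measure \<mu> (log_sum lam K L) \<ge> measure \<mu> K powr lam * measure \<mu> L powr (1 - lam))
       \<and> (\<forall>K :: (real ^ 2) set. symmetric_convex_body K \<longrightarrow>
            log_concave (\<lambda>t :: real. measure \<mu> ((\<lambda>x. exp t *\<^sub>R x) ` K)))"
proof (intro conjI allI impI)
  show main: "measure \<mu> K powr lam * measure \<mu> L powr (1 - lam) \<le> measure \<mu> (log_sum lam K L)"
    if "symmetric_convex_body K" "symmetric_convex_body L" "0 < lam" "lam < 1" for K L lam
    using even_log_concave_log_sum(1)[OF assms(1,2) that] by (simp add: assms(3))
  fix K :: "(real ^ 2) set" assume K: "symmetric_convex_body K"
  define \<nu> where "\<nu> t = measure \<mu> ((*\<^sub>R) (exp t) ` K)" for t :: real
  have "log_concave \<nu>" unfolding log_concave_def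
  proof (intro conjI allI ballI)
    show "0 \<le> \<nu> t" for t by (simp add: \<nu>_def)
    fix x y t :: real assume t: "t \<in> {0..1}"
    show "ereal (1 - t) * eln (\<nu> x) + ereal t * eln (\<nu> y) \<le> eln (\<nu> ((1 - t) *\<^sub>R x + t *\<^sub>R y))"
    proof (cases "t = 0 \<or> t = 1")
      case True
      then show ?thesis by (auto simp: one_ereal_def[symmetric] zero_ereal_def[symmetric])
    next
      case False
      then have t: "0 < t" "t < 1" using t by auto
      let ?z = "(1 - t) * x + t * y"
      have body: "symmetric_convex_body ((*\<^sub>R) (exp s) ` K)" for s
        by (rule symmetric_convex_body_scaleR[OF K]) simp
      have "exp x powr (1 - t) * exp y powr (1 - (1 - t)) = exp ?z"
        by (simp add: powr_def flip: exp_add)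
      then have sub: "log_sum (1 - t) ((*\<^sub>R) (exp x) ` K) ((*\<^sub>R) (exp y) ` K) \<subseteq> (*\<^sub>R) (exp ?z) ` K"
        using log_sum_scaleR_subset[OF K, of "exp x" "exp y" "1 - t"] by simp
      \<comment> \<open>The exponent \<open>1 - (1 - t)\<close> is what the first claim yields for
        the weight \<open>1 - t\<close>.\<close>
      have "\<nu> x powr (1 - t) * \<nu> y powr (1 - (1 - t)) \<le> measure \<mu> (log_sum (1 - t) ((*\<^sub>R) (exp x) ` K) ((*\<^sub>R) (exp y) ` K))"
        unfolding \<nu>_def using t by (intro main body) auto
      also have "\<dots> \<le> \<nu> ?z" unfolding \<nu>_def
      \<comment> \<open>\<open>measure\<close> is 0 on sets of infinite measure, so monotonicity
        needs the dilate to have finite measure.\<close>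
      proof (rule measure_mono_fmeasurable[OF sub])
        have fm: "S \<in> fmeasurable \<mu>" if "symmetric_convex_body S" for S
          using even_log_concave_log_sum(2)[OF assms(1,2) K K t] that
          by (simp add: assms(3) lmeasurable_compact symmetric_convex_bodyD(1))
        show "(*\<^sub>R) (exp ?z) ` K \<in> fmeasurable \<mu>" by (rule fm[OF body])
        show "log_sum (1 - t) ((*\<^sub>R) (exp x) ` K) ((*\<^sub>R) (exp y) ` K) \<in> sets \<mu>"
          using t by (intro fmeasurableD fm log_sum_symmetric_convex_body body) auto
      qed
      finally show ?thesis
        using t by (intro eln_weighted_le) (simp_all add: \<nu>_def)
    qed
  qed
  then show "log_concave (\<lambda>t. measure \<mu> ((\<lambda>x. exp t *\<^sub>R x) ` K))" by (simp add: \<nu>_def[abs_def])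
qed

end
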